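(* There exists an $(\mathbb{F}_{17}\times\mathbb{F}_q,\mathbb{F}_{17}\times\{0\},17,1)$-DF for every prime $q\equiv 1 \pmod{16}$ such that either $q>Q(4,13)$ (numerically $Q(4,13)\approx 3.44807\times 10^{17}$), or $q\in S_{17}$, or $6673\leq q\leq 9857$, where $S_{17}=\{17, 881, 1297, 1601, 1873, 2017, 2129, 2657, 2753, 2801, 2897, 3089, 3121, 3217, 3313, 3361, 3617, 3697, 3761, 3793, 3889, 4001, 4049, 4129, 4241, 4273, 4289, 4481, 4561, 4657, 4721, 4801, 4817, 4993, 5009, 5233, 5281, 5297, 5393, 5441, 5521, 5569, 5857, 5953, 6113, 6257, 6337, 6449, 6529\}$.
   Context: For an additive group $G$ with a subgroup $N$, a $(G,N,k,\lambda)$ relative difference family (DF) is a multiset $[B_1,\dots,B_r]$ of $k$-subsets of $G$ such that the multiset $\bigcup_{i}[x-y: x,y\in B_i, x\neq y]$ contains every element of $G\setminus N$ exactly $\lambda$ times and no element of $N$. For positive integers $d,m$, $Q(d,m)=\frac{1}{4}\left(U+\sqrt{U^2+4d^{m-1}m}\right)^2$ where $U=\sum_{h=1}^m \binom{m}{h}(d-1)^h(h-1)$. *)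

theory Defs
  imports Complex_Main "HOL-Library.Multiset" "HOL-Algebra.Group" "HOL-Number_Theory.Residues"
begin

(* The group G is given by HOL-Algebra's multiplicative record, so that the
   difference x - y of the additive notation reads x \<otimes> inv y. *)

definition difference_list :: "('a, 'b) monoid_scheme \<Rightarrow> 'a set \<Rightarrow> 'a multiset" where
  "difference_list G B =
     {# x \<otimes>\<^bsub>G\<^esub> inv\<^bsub>G\<^esub> y. (x, y) \<in># mset_set {(x, y) \<in> B \<times> B. x \<noteq> y} #}"

(* "finite B" is stated separately because card is 0 on infinite sets. *)
definition relative_difference_family ::
  "('a, 'b) monoid_scheme \<Rightarrow> 'a set \<Rightarrow> nat \<Rightarrow> nat \<Rightarrow> 'a set multiset \<Rightarrow> bool" where
  "relative_difference_family G N k l Bs \<longleftrightarrow>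
     group G \<and> subgroup N G \<and>
     (\<forall>B \<in># Bs. B \<subseteq> carrier G \<and> finite B \<and> card B = k) \<and>
     (\<forall>g \<in> carrier G.
        count (\<Sum>B \<in># Bs. difference_list G B) g = (if g \<in> N then 0 else l))"

(* For a prime p, residue_ring p is the field with p elements, with carrier {0..p - 1}. *)
abbreviation prime_field_add :: "nat \<Rightarrow> int monoid" where
  "prime_field_add p \<equiv> add_monoid (residue_ring (int p))"

definition Q_bound_U :: "nat \<Rightarrow> nat \<Rightarrow> real" where
  "Q_bound_U d m = (\<Sum>h = 1..m. real (m choose h) * (real d - 1) ^ h * (real h - 1))"

definition Q_bound :: "nat \<Rightarrow> nat \<Rightarrow> real" where
  "Q_bound d m =
     1 / 4 * (Q_bound_U d m + sqrt ((Q_bound_U d m)\<^sup>2 + 4 * real d ^ (m - 1) * real m))\<^sup>2"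

definition S17 :: "nat set" where
  "S17 = {17, 881, 1297, 1601, 1873, 2017, 2129, 2657, 2753, 2801, 2897, 3089, 3121, 3217,
    3313, 3361, 3617, 3697, 3761, 3793, 3889, 4001, 4049, 4129, 4241, 4273, 4289, 4481, 4561,
    4657, 4721, 4801, 4817, 4993, 5009, 5233, 5281, 5297, 5393, 5441, 5521, 5569, 5857, 5953,
    6113, 6257, 6337, 6449, 6529}"

lemma Q_bound_4_13: "\<bar>Q_bound 4 13 - 344807 * 10 ^ 12\<bar> < 10 ^ 12 / 2"
proof -
  have U: "Q_bound_U 4 13 = 587202561"
    unfolding Q_bound_U_def by (simp add: sum.atLeast_Suc_atMost numeral_eq_Suc fact_numeral binomial_fact)
  define s where "s = sqrt ((587202561::real)\<^sup>2 + 4 * 4 ^ 12 * 13)"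
  have s1: "587202561 \<le> s" unfolding s_def by (rule real_le_rsqrt) simp
  have s2: "s \<le> 587202564" unfolding s_def by (rule real_le_lsqrt) simp_all
  have Q: "Q_bound 4 13 = 1 / 4 * (587202561 + s)\<^sup>2"
    unfolding Q_bound_def U s_def by simp
  have "(587202561 + 587202561 :: real)\<^sup>2 \<le> (587202561 + s)\<^sup>2"
    using s1 by (intro power_mono) auto
  moreover have "(587202561 + s)\<^sup>2 \<le> (587202561 + 587202564 :: real)\<^sup>2"
    using s1 s2 by (intro power_mono) auto
  ultimately show ?thesis unfolding Q by (simp add: abs_if)
qed

end

theory Submission
  imports Defs "HOL-Number_Theory.Number_Theory" "Berlekamp_Zassenhaus.Finite_Field"
begin

text \<open>
  Fix \<open>i\<close> with \<open>i\<^sup>2 = - 1\<close> in the field with \<open>q\<close> elements and consider the block consisting of \<open>(0, 0)\<close> and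
  \<open>((- 1)\<^sup>k r, i\<^sup>k b\<^sub>r)\<close> for \<open>r \<in> {1, 2, 4, 8}\<close> and \<open>k < 4\<close>; the first coordinates are \<open>0\<close> and every nonzero square modulo
  \<open>17\<close> twice. For each \<open>g\<close> the differences with first coordinate \<open>g\<close> have as second coordinates the
  multiples by fourth roots of unity of four elements. If for each \<open>g\<close> these lie in distinct
  classes modulo fourth powers, then the multiples of the block by representatives of the fourth
  powers modulo the fourth roots of unity form the required family.

  For the finitely many small \<open>q\<close> suitable \<open>b\<^sub>r\<close> are listed. For large \<open>q\<close> one takes \<open>b\<^sub>1 = 1\<close> and chooses
  \<open>b\<^sub>2\<close>, \<open>b\<^sub>4\<close>, \<open>b\<^sub>8\<close> one after the other, which amounts to finding \<open>z\<close> such that up to \<open>13\<close> values \<open>z - c\<close> have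
  prescribed quartic characters. Instead of Weil's bound, a bound for character sums with a worse
  constant is obtained by Stepanov's polynomial method. This suffices since for \<open>b\<^sub>8\<close> not all the
  characters have to be prescribed.
\<close>

subsection \<open>Difference families from quartic classes\<close>

lemma size_difference_list:
  assumes "finite B"
  shows "size (difference_list G B) = card B * (card B - 1)"
proof -
  have "{(x, y) \<in> B \<times> B. x \<noteq> y} = (SIGMA x : B. B - {x})" by auto
  thus ?thesis using assms by (simp add: difference_list_def)
qed

text \<open>The size bound leaves no room for a difference to occur twice or to lie in \<open>N\<close>, so a family
  that covers the complement of \<open>N\<close> is a difference family.\<close>

lemma relative_difference_family_if_covering:
  assumes G: "group G" "finite (carrier G)" "subgroup N G" and k: "2 \<le> k"
    and blocks: "\<And>B. B \<in># Bs \<Longrightarrow> B \<subseteq> carrier G \<and> card B \<le> k"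
    and size: "size Bs * (k * (k - 1)) \<le> card (carrier G - N)"
    and cover: "\<And>g. g \<in> carrier G - N \<Longrightarrow>
      \<exists>B x y. B \<in># Bs \<and> x \<in> B \<and> y \<in> B \<and> x \<noteq> y \<and> g = x \<otimes>\<^bsub>G\<^esub> inv\<^bsub>G\<^esub> y"
  shows "relative_difference_family G N k 1 Bs"
proof -
  define D where "D = (\<Sum>B \<in># Bs. difference_list G B)"
  have fin: "finite B" if "B \<in># Bs" for B
    using blocks[OF that] G(2) finite_subset by blast
  have mono: "card B * (card B - 1) \<le> k * (k - 1)" if "B \<in># Bs" for B
    using blocks[OF that] by (intro mult_mono) auto
  have size_D: "size D = (\<Sum>B \<in># Bs. card B * (card B - 1))"
    unfolding D_def size_mset_sum_mset_conv multiset.map_comp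
    by (intro arg_cong[where f = sum_mset] image_mset_cong) (simp add: size_difference_list fin)
  \<comment> \<open>Stated for submultisets because it serves both \<open>Bs\<close> and
    \<open>Bs\<close> with one block removed.\<close>
  have sum_le: "(\<Sum>B \<in># A. card B * (card B - 1)) \<le> size A * (k * (k - 1))" if "A \<subseteq># Bs" for A
    using that
  proof (induction A)
    case (add B A)
    hence "B \<in># Bs" "A \<subseteq># Bs" by (auto dest: mset_subset_eq_insertD intro: subset_mset.less_imp_le)
    thus ?case using add.IH mono[of B] by simp
  qed simp
  have "mset_set (carrier G - N) \<subseteq># D"
  proof (rule mset_subset_eqI)
    fix g
    have "g \<in># D" if "g \<in> carrier G - N"
    proof -
      obtain B x y where B: "B \<in># Bs" "x \<in> B" "y \<in> B" "x \<noteq> y" "g = x \<otimes>\<^bsub>G\<^esub> inv\<^bsub>G\<^esub> y"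
        using cover[OF \<open>g \<in> carrier G - N\<close>] by blast
      have "finite {(x, y) \<in> B \<times> B. x \<noteq> y}"
        using fin[OF B(1)] by (auto intro: finite_subset[of _ "B \<times> B"])
      hence "g \<in># difference_list G B"
        using B by (force simp: difference_list_def)
      thus ?thesis using B(1) by (auto simp: D_def)
    qed
    thus "count (mset_set (carrier G - N)) g \<le> count D g"
      using G(2) by (cases "g \<in> carrier G - N") (auto simp: Suc_le_eq)
  qed
  moreover have size_le: "size D \<le> size (mset_set (carrier G - N))"
    using sum_le[of Bs] size by (simp add: size_D)
  ultimately have D: "D = mset_set (carrier G - N)"
    by (metis leD mset_subset_size subset_mset.le_less)
  \<comment> \<open>The size of \<open>D\<close> is now known to reach
    \<open>size Bs * (k * (k - 1))\<close>; a smaller block would leave a deficit that the other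
    blocks cannot make up.\<close>
  have "card B = k" if B: "B \<in># Bs" for B
  proof (rule ccontr)
    assume "card B \<noteq> k"
    hence less: "card B < k" using blocks[OF B] by simp
    obtain A where A: "Bs = add_mset B A" using B by (metis mset_add)
    have "size Bs * (k * (k - 1)) \<le> card B * (card B - 1) + size A * (k * (k - 1))"
      using size sum_le[of A] size_D unfolding D by (simp add: A)
    hence "k * (k - 1) \<le> card B * (card B - 1)" by (simp add: A)
    also have "\<dots> \<le> card B * (k - 1)" using less by (intro mult_left_mono) auto
    also have "\<dots> < k * (k - 1)" using less k by (intro mult_strict_right_mono) auto
    finally show False by simp
  qed
  moreover have "count D g = (if g \<in> N then 0 else 1)" if "g \<in> carrier G" for g
    using that G(2) by (simp add: D)
  ultimately show ?thesis
    using G(1,3) blocks fin by (auto simp: relative_difference_family_def D_def)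
qed

lemma group_prime_field_add: "prime p \<Longrightarrow> group (prime_field_add p)"
proof -
  assume p: "prime p"
  interpret residues "int p" "residue_ring (int p)"
    by unfold_locales (use prime_gt_1_nat[OF p] in simp_all)
  show ?thesis by (rule a_group)
qed

lemma inv_prime_field_add:
  "prime p \<Longrightarrow> x \<in> carrier (prime_field_add p) \<Longrightarrow> inv\<^bsub>prime_field_add p\<^esub> x = (- x) mod int p"
proof -
  assume p: "prime p"
  interpret residues "int p" "residue_ring (int p)"
    by unfold_locales (use prime_gt_1_nat[OF p] in simp_all)
  show ?thesis using res_neg_eq[of x] by (simp add: a_inv_def)
qed

lemma prime_field_add_mult: "x \<otimes>\<^bsub>prime_field_add p\<^esub> y = (x + y) mod int p"
  by (simp add: residue_ring_def)

text \<open>The block has first coordinates \<open>\<plusminus>1, \<plusminus>2, \<plusminus>4, \<plusminus>8\<close> with parameters \<open>b\<^sub>1 = 1\<close>, \<open>b\<^sub>2 = x\<close>, \<open>b\<^sub>4 = y\<close>, \<open>b\<^sub>8 = z\<close>.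
  Up to multiplication by powers of \<open>i\<close>, the differences with first coordinate \<open>\<plusminus>g\<close> are the entries of
  row \<open>g\<close> for \<open>0 \<le> g \<le> 8\<close>.\<close>

definition quads :: "'a::comm_ring_1 \<Rightarrow> 'a \<Rightarrow> 'a \<Rightarrow> 'a \<Rightarrow> 'a list list" where
  "quads i x y z =
    [[2, 2 * x, 2 * y, 2 * z],
     [1, z * (1 + i), 1 + x, 1 - x],
     [x, 1 + i, x + y, x - y],
     [x + i, x - i, 1 + y, 1 - y],
     [y, x * (1 + i), y + z, y - z],
     [y + i, y - i, y + i * z, y - i * z],
     [x + i * y, x - i * y, x + z, x - z],
     [1 + z, 1 - z, x + i * z, x - i * z],
     [z, y * (1 + i), z + i, z - i]]"

text \<open>The four entries for each \<open>(r, b)\<close> are its orbit under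
  \<open>(a, c) \<mapsto> (- a, i * c)\<close>, with \<open>i\<^sup>2\<close> replaced by
  \<open>- 1\<close>. They are unreduced integers, hence the congruences in
  \<open>template_diff\<close>.\<close>

definition template :: "int \<Rightarrow> int \<Rightarrow> int \<Rightarrow> int \<Rightarrow> (int \<times> int) list" where
  "template i x y z = (0, 0) #
     concat (map (\<lambda>(r, b). [(r, b), (- r, i * b), (r, - b), (- r, - (i * b))]) [(1, 1), (2, x), (4, y), (8, z)])"

definition template_diff :: "int \<Rightarrow> int \<Rightarrow> int \<Rightarrow> int \<Rightarrow> int \<Rightarrow> int \<Rightarrow> int \<Rightarrow> bool" where
  "template_diff p i x y z g v \<longleftrightarrow> (\<exists>(a, b) \<in> set (template i x y z). \<exists>(c, d) \<in> set (template i x y z).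
     [g = a - c] (mod 17) \<and> [v = b - d] (mod p))"

text \<open>The automorphism \<open>(a, c) \<mapsto> (- a, i * c)\<close> maps the block to itself
  modulo \<open>p\<close>, and therefore permutes its differences.\<close>

lemma template_diff_turn:
  assumes "p dvd i\<^sup>2 + 1" "template_diff p i x y z g v"
  shows "template_diff p i x y z (- g) (i * v)"
proof -
  have turn: "\<exists>(c, d) \<in> set (template i x y z). c = - a \<and> [d = i * b] (mod p)"
    if "(a, b) \<in> set (template i x y z)" for a b
  proof -
    have i2: "[- w = i * (i * w)] (mod p)" and i3: "[w = - (i * (i * w))] (mod p)" for w
    proof -
      have "- w - i * (i * w) = (i\<^sup>2 + 1) * (- w)" "w - - (i * (i * w)) = (i\<^sup>2 + 1) * w"
        by (simp_all add: power2_eq_square algebra_simps)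
      thus "[- w = i * (i * w)] (mod p)" "[w = - (i * (i * w))] (mod p)"
        using assms(1) by (simp_all only: cong_iff_dvd_diff dvd_mult2)
    qed
    have i2': "[- 1 = i * i] (mod p)" and i3': "[1 = - (i * i)] (mod p)"
      using i2[of 1] i3[of 1] by simp_all
    show ?thesis
      using that unfolding template_def
      by (simp, elim disjE; simp add: i2 i3 i2' i3')
  qed
  from assms(2) obtain a b c d where *: "(a, b) \<in> set (template i x y z)" "(c, d) \<in> set (template i x y z)"
    "[g = a - c] (mod 17)" "[v = b - d] (mod p)"
    by (auto simp: template_diff_def)
  obtain b' d' where **: "(- a, b') \<in> set (template i x y z)" "[b' = i * b] (mod p)"
    "(- c, d') \<in> set (template i x y z)" "[d' = i * d] (mod p)"
    using turn[OF *(1)] turn[OF *(2)] by blast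
  have "[- g = - a - - c] (mod 17)"
    using *(3) by (simp add: cong_iff_dvd_diff) presburger
  moreover have "[i * v = i * (b - d)] (mod p)"
    using *(4) by (rule cong_scalar_left)
  hence "[i * v = b' - d'] (mod p)"
    using cong_diff[OF **(2,4)] by (metis cong_sym cong_trans right_diff_distrib)
  ultimately show ?thesis
    using ** unfolding template_diff_def by blast
qed

lemma template_diff_neg:
  assumes "template_diff p i x y z g v"
  shows "template_diff p i x y z (- g) (- v)"
proof -
  from assms obtain a b c d where *: "(a, b) \<in> set (template i x y z)" "(c, d) \<in> set (template i x y z)"
    "[g = a - c] (mod 17)" "[v = b - d] (mod p)"
    by (auto simp: template_diff_def)
  moreover have "[- g = c - a] (mod 17)" "[- v = d - b] (mod p)"
    using *(3,4) by (metis cong_minus_minus_iff minus_diff_eq)+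
  ultimately show ?thesis unfolding template_diff_def by blast
qed

lemma template_diff_cong:
  assumes "template_diff p i x y z g v" "[v = w] (mod p)"
  shows "template_diff p i x y z g w"
proof -
  from assms(1) obtain a b c d where "(a, b) \<in> set (template i x y z)" "(c, d) \<in> set (template i x y z)"
    "[g = a - c] (mod 17)" "[v = b - d] (mod p)"
    by (auto simp: template_diff_def)
  moreover from this(4) have "[w = b - d] (mod p)"
    using assms(2) by (metis cong_sym cong_trans)
  ultimately show ?thesis unfolding template_diff_def by blast
qed

text \<open>Two turns and a negation send \<open>(g, v)\<close> to
  \<open>(- g, - i\<^sup>2 v)\<close>, which is \<open>(- g, v)\<close> modulo \<open>p\<close>. So
  the sign of \<open>g\<close> is free, and a turn followed by this flip multiplies \<open>v\<close>
  by \<open>i\<close> while \<open>g\<close> stays.\<close>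

lemma template_diff_i_power:
  assumes i: "p dvd i\<^sup>2 + 1" and diff: "template_diff p i x y z g v" and h: "h = g \<or> h = - g"
  shows "template_diff p i x y z h (i ^ k * v)"
proof -
  have flip: "template_diff p i x y z (- g') w" if "template_diff p i x y z g' w" for g' w
  proof -
    have "template_diff p i x y z (- g') (- (i * (i * w)))"
      using template_diff_neg[OF template_diff_turn[OF i template_diff_turn[OF i that]]] by simp
    moreover have "- (i * (i * w)) - w = (i\<^sup>2 + 1) * (- w)"
      by (simp add: power2_eq_square algebra_simps)
    hence "[- (i * (i * w)) = w] (mod p)"
      using i by (simp only: cong_iff_dvd_diff dvd_mult2)
    ultimately show ?thesis by (rule template_diff_cong)
  qed
  have "template_diff p i x y z g (i * w)" if "template_diff p i x y z g w" for w
    using flip[OF template_diff_turn[OF i that]] by simp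
  hence "template_diff p i x y z g (i ^ k * v)"
    by (induction k) (use diff in \<open>auto simp: mult.assoc\<close>)
  thus ?thesis using h flip by blast
qed

lemma quads_template_diff:
  assumes i: "p dvd i\<^sup>2 + 1"
  shows "\<exists>vs \<in> set (quads i x y z). \<forall>v \<in> set vs. \<forall>k. template_diff p i x y z g (i ^ k * v)"
proof -
  \<comment> \<open>For each \<open>g\<close> up to \<open>8\<close> these are four pairs of block
    elements whose first coordinates differ by \<open>g\<close> or \<open>- g\<close> modulo
    \<open>17\<close> and whose second coordinates differ by the entries of row \<open>g\<close> of
    \<open>quads\<close>.\<close>
  define P :: "(int \<times> ((int \<times> int) \<times> (int \<times> int)) list) list" where "P =
    [(0, [((1, 1), (1, - 1)), ((2, x), (2, - x)), ((4, y), (4, - y)), ((8, z), (8, - z))]),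
     (1, [((1, 1), (0, 0)), ((8, z), (- 8, - (i * z))), ((1, 1), (2, - x)), ((1, 1), (2, x))]),
     (2, [((2, x), (0, 0)), ((1, 1), (- 1, - i)), ((2, x), (4, - y)), ((2, x), (4, y))]),
     (3, [((2, x), (- 1, - i)), ((2, x), (- 1, i)), ((1, 1), (4, - y)), ((1, 1), (4, y))]),
     (4, [((4, y), (0, 0)), ((2, x), (- 2, - (i * x))), ((4, y), (8, - z)), ((4, y), (8, z))]),
     (5, [((4, y), (- 1, - i)), ((4, y), (- 1, i)), ((4, y), (- 8, - (i * z))), ((4, y), (- 8, i * z))]),
     (6, [((2, x), (- 4, - (i * y))), ((2, x), (- 4, i * y)), ((2, x), (8, - z)), ((2, x), (8, z))]),
     (7, [((1, 1), (8, - z)), ((1, 1), (8, z)), ((2, x), (- 8, - (i * z))), ((2, x), (- 8, i * z))]),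
     (8, [((8, z), (0, 0)), ((4, y), (- 4, - (i * y))), ((8, z), (- 1, - i)), ((8, z), (- 1, i))])]"
  have P: "\<forall>(g, row) \<in> set P. \<forall>((a, b), (c, d)) \<in> set row.
      (a, b) \<in> set (template i x y z) \<and> (c, d) \<in> set (template i x y z) \<and>
      ([g = a - c] (mod 17) \<or> [- g = a - c] (mod 17))"
    by (simp add: P_def template_def cong_def)
  have quads: "quads i x y z = map (\<lambda>(g, row). map (\<lambda>((a, b), (c, d)). b - d) row) P"
    by (simp add: quads_def P_def algebra_simps)
  have "g mod 17 = 0 \<or> g mod 17 = 1 \<or> g mod 17 = 2 \<or> g mod 17 = 3 \<or> g mod 17 = 4 \<or> g mod 17 = 5 \<or>
    g mod 17 = 6 \<or> g mod 17 = 7 \<or> g mod 17 = 8 \<or> g mod 17 = 9 \<or> g mod 17 = 10 \<or> g mod 17 = 11 \<or>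
    g mod 17 = 12 \<or> g mod 17 = 13 \<or> g mod 17 = 14 \<or> g mod 17 = 15 \<or> g mod 17 = 16"
    by presburger
  hence "\<exists>(h, row) \<in> set P. [h = g] (mod 17) \<or> [- h = g] (mod 17)"
    by (auto simp: P_def cong_def)
  then obtain h row where row: "(h, row) \<in> set P" "[h = g] (mod 17) \<or> [- h = g] (mod 17)"
    by blast
  have "template_diff p i x y z g (i ^ k * v)"
    if v: "v \<in> set (map (\<lambda>((a, b), (c, d)). b - d) row)" for v k
  proof -
    obtain e where e: "e \<in> set row" "v = (\<lambda>((a, b), (c, d)). b - d) e"
      using v by auto
    obtain a b c d where "e = ((a, b), (c, d))" by (metis surj_pair)
    hence abcd: "((a, b), (c, d)) \<in> set row" "v = b - d" using e by simp_all
    have *: "(a, b) \<in> set (template i x y z)" "(c, d) \<in> set (template i x y z)"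
      "[h = a - c] (mod 17) \<or> [- h = a - c] (mod 17)"
      using P row(1) abcd(1) by fast+
    have "[g = a - c] (mod 17) \<or> [g = - (a - c)] (mod 17)"
      using row(2) *(3) by (metis cong_minus_minus_iff cong_sym cong_trans minus_minus)
    then obtain g' where "[g' = a - c] (mod 17)" "g = g' \<or> g = - g'"
      by (metis cong_minus_minus_iff minus_minus)
    moreover from this(1) have "template_diff p i x y z g' v"
      using *(1,2) abcd(2) unfolding template_diff_def
      by (intro bexI[OF _ *(1)] case_prodI bexI[OF _ *(2)] conjI) auto
    ultimately show ?thesis by (intro template_diff_i_power[OF i])
  qed
  moreover have "map (\<lambda>((a, b), (c, d)). b - d) row \<in> set (quads i x y z)"
    using row(1) unfolding quads by force
  ultimately show ?thesis by blast
qed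

text \<open>Modulo \<open>i\<^sup>2 + 1\<close> the polynomial \<open>X ^ 4 - 1\<close> splits into
  linear factors with roots \<open>1\<close>, \<open>- 1\<close>, \<open>i\<close>,
  \<open>- i\<close>, and a prime divisor must divide one factor.\<close>

lemma fourth_root_of_unity_cong:
  fixes u :: int
  assumes p: "prime p" and i: "p dvd i\<^sup>2 + 1" and u: "[u ^ 4 = 1] (mod p)"
  shows "\<exists>k. [u = i ^ k] (mod p)"
proof -
  have "(u - 1) * (u + 1) * ((u - i) * (u + i)) = u ^ 4 - 1 + (i\<^sup>2 + 1) * (1 - u\<^sup>2)"
    by (simp add: algebra_simps power2_eq_square power4_eq_xxxx)
  moreover have "p dvd u ^ 4 - 1 + (i\<^sup>2 + 1) * (1 - u\<^sup>2)"
    using u i unfolding cong_iff_dvd_diff by (rule dvd_add[OF _ dvd_mult2])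
  ultimately have "p dvd (u - 1) * (u + 1) * ((u - i) * (u + i))" by simp
  hence "p dvd u - 1 \<or> p dvd u + 1 \<or> p dvd u - i \<or> p dvd u + i"
    using p by (auto simp: prime_dvd_mult_iff)
  moreover have "u - i\<^sup>2 = u + 1 - (i\<^sup>2 + 1)" "u - i ^ 3 = u + i - (i\<^sup>2 + 1) * i"
    by (simp_all add: algebra_simps power2_eq_square power3_eq_cube)
  hence "p dvd u + 1 \<Longrightarrow> p dvd u - i\<^sup>2" "p dvd u + i \<Longrightarrow> p dvd u - i ^ 3"
    using i by (metis dvd_diff, metis dvd_diff dvd_mult2)
  ultimately show ?thesis
    unfolding cong_iff_dvd_diff by (metis power_0 power_one_right)
qed

text \<open>Take for \<open>r\<close> the fourth power of a primitive root. The fourth powers form a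
  cyclic group of order \<open>(p - 1) div 4\<close> generated by \<open>r\<close>, which contains
  the fourth roots of unity; the first \<open>(p - 1) div 16\<close> powers of \<open>r\<close>
  represent the quotient.\<close>

lemma quartic_coset_representatives:
  assumes p: "prime (p :: nat)" "16 dvd p - 1" and i: "int p dvd i\<^sup>2 + 1"
  shows "\<exists>r :: int. \<forall>d v. \<not> int p dvd d \<longrightarrow> \<not> int p dvd v \<longrightarrow>
     [d ^ ((p - 1) div 4) = v ^ ((p - 1) div 4)] (mod int p) \<longrightarrow>
     (\<exists>j < (p - 1) div 16. \<exists>k. [d = i ^ k * v * r ^ j] (mod int p))"
proof -
  obtain m where m: "p - 1 = 16 * m" using p(2) by blast
  have m0: "0 < m" using prime_gt_1_nat[OF p(1)] m by (cases m) auto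
  have p1: "1 < p" using prime_gt_1_nat[OF p(1)] .
  obtain a where a_prim: "residue_primroot p a"
    using prime_primitive_root_exists[OF p1 p(1)] by blast
  hence a: "coprime p a" "ord p a = p - 1"
    by (auto simp: residue_primroot_def totient_prime[OF p(1)])
  have bij: "bij_betw (\<lambda>e. a ^ e mod p) {..<totient p} (totatives p)"
    by (rule residue_primroot_is_generator[OF p1 a_prim])
  let ?g = "int a"
  have log: "\<exists>e. [w = ?g ^ e] (mod int p)" if "\<not> int p dvd w" for w :: int
  proof -
    define w' where "w' = nat (w mod int p)"
    have w': "int w' = w mod int p" using p1 by (simp add: w'_def)
    have "w' \<in> totatives p"
      unfolding totatives_prime[OF p(1)]
      using that p1 by (auto simp: w'_def dvd_eq_mod_eq_0 nat_less_iff order.not_eq_order_implies_strict)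
    then obtain e where "w' = a ^ e mod p"
      using bij by (auto simp: bij_betw_def)
    hence "w mod int p = ?g ^ e mod int p"
      using w' by (metis of_nat_mod of_nat_power)
    thus ?thesis by (auto simp: cong_def)
  qed
  have order: "[?g ^ e = ?g ^ e'] (mod int p) \<longleftrightarrow> [e = e'] (mod 16 * m)" for e e'
    using order_divides_expdiff[OF a(1), of e e'] a(2) m
    by (metis cong_int_iff of_nat_power)
  have root: "[(?g ^ (4 * m)) ^ 4 = 1] (mod int p)"
    using order[of "16 * m" 0] by (simp add: cong_def flip: power_mult)
  then obtain t where t: "[?g ^ (4 * m) = i ^ t] (mod int p)"
    using fourth_root_of_unity_cong[OF _ i] p(1) by auto
  have "\<exists>j < m. \<exists>k. [d = i ^ k * v * (?g ^ 4) ^ j] (mod int p)"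
    if d: "\<not> int p dvd d" and v: "\<not> int p dvd v" and eq: "[d ^ (4 * m) = v ^ (4 * m)] (mod int p)" for d v
  proof -
    obtain e e' where e: "[d = ?g ^ e] (mod int p)" "[v = ?g ^ e'] (mod int p)"
      using log d v by blast
    have "[?g ^ (e * (4 * m)) = ?g ^ (e' * (4 * m))] (mod int p)"
      using cong_trans[OF cong_trans[OF cong_sym[OF cong_pow[OF e(1)]] eq] cong_pow[OF e(2)]]
      by (simp only: power_mult)
    hence "(e * (4 * m)) mod (4 * (4 * m)) = (e' * (4 * m)) mod (4 * (4 * m))"
      unfolding order by (simp add: cong_def)
    hence e4: "e mod 4 = e' mod 4"
      unfolding mod_mult_mult2 using m0 by simp
    \<comment> \<open>Since \<open>4 * s + 3\<close> is \<open>16 * m - 1\<close>, the exponent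
      \<open>e + (4 * s + 3) * e'\<close> below plays the role of \<open>e - e'\<close> without a
      subtraction of naturals.\<close>
    obtain s where s: "16 * m = 4 * s + 4"
      using m0 by (intro that[of "4 * m - 1"]) simp
    have "4 dvd e + 3 * e'" using e4 by presburger
    then obtain f' where f': "e + 3 * e' = 4 * f'" ..
    define f where "f = s * e' + f'"
    have f: "e + (4 * s + 3) * e' = 4 * f"
      using f' by (simp add: f_def algebra_simps)
    \<comment> \<open>Division of \<open>f\<close> by \<open>m\<close>: the quotient contributes
      powers of \<open>?g ^ (4 * m)\<close>, a fourth root of unity, and the remainder is the index
      \<open>j\<close>.\<close>
    have "4 * f = 4 * m * (f div m) + 4 * (f mod m)"
      by (simp flip: distrib_left add: mult.assoc)
    hence "?g ^ (4 * f) = (?g ^ (4 * m)) ^ (f div m) * (?g ^ 4) ^ (f mod m)"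
      by (simp only: power_add power_mult)
    hence gf: "[?g ^ (4 * f) = (i ^ t) ^ (f div m) * (?g ^ 4) ^ (f mod m)] (mod int p)"
      using cong_scalar_right[OF cong_pow[OF t, of "f div m"], of "(?g ^ 4) ^ (f mod m)"] by simp
    have "[?g ^ e = ?g ^ e' * ?g ^ (4 * f)] (mod int p)"
    proof -
      have "e' + 4 * f = e + 16 * m * e'" unfolding s using f by (simp add: algebra_simps)
      thus ?thesis unfolding power_add[symmetric] order by (simp add: cong_def)
    qed
    hence "[d = v * ((i ^ t) ^ (f div m) * (?g ^ 4) ^ (f mod m))] (mod int p)"
      using cong_trans[OF e(1) cong_trans[OF _ cong_mult[OF cong_sym[OF e(2)] gf]]] by blast
    hence "[d = i ^ (t * (f div m)) * v * (?g ^ 4) ^ (f mod m)] (mod int p)"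
      by (simp add: power_mult mult_ac)
    thus ?thesis using m0 by (intro exI[of _ "f mod m"]) auto
  qed
  thus ?thesis using m by (intro exI[of _ "?g ^ 4"]) simp
qed

text \<open>By Fermat these powers of units are roots of \<open>X ^ 4 = 1\<close>, which has at most
  four roots modulo \<open>p\<close>; four distinct values exhaust them.\<close>

lemma quartic_classes_exhaustive:
  fixes p :: nat and d :: int
  assumes p: "prime p" "4 dvd p - 1"
    and vs: "length vs = 4" "distinct (map (\<lambda>v. v ^ ((p - 1) div 4) mod int p) vs)"
      "\<And>v. v \<in> set vs \<Longrightarrow> \<not> int p dvd v"
    and d: "\<not> int p dvd d"
  shows "\<exists>v \<in> set vs. [d ^ ((p - 1) div 4) = v ^ ((p - 1) div 4)] (mod int p)"
proof -
  define n where "n = (p - 1) div 4"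
  define A where "A = {x \<in> {..<p}. [x ^ 4 = 1] (mod p)}"
  define f where "f = (\<lambda>v. nat (v ^ n mod int p))"
  have p0: "0 < int p" using prime_gt_0_nat[OF p(1)] by simp
  have int_f: "int (f v) = v ^ n mod int p" for v
    using p0 by (simp add: f_def)
  have f_A: "f v \<in> A" if "\<not> int p dvd v" for v
  proof -
    define w where "w = nat (v mod int p)"
    have w: "int w = v mod int p" using p0 by (simp add: w_def)
    hence "\<not> p dvd w" using that by (metis int_dvd_int_iff mod_mod_trivial dvd_eq_mod_eq_0)
    hence "[w ^ (p - 1) = 1] (mod p)" by (rule fermat_theorem[OF p(1)])
    moreover have "p - 1 = n * 4" using p(2) by (simp add: n_def)
    ultimately have "[(int w ^ n) ^ 4 = 1] (mod int p)"
      by (metis cong_int_iff of_nat_1 of_nat_power power_mult)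
    hence "[int (f v) ^ 4 = 1] (mod int p)"
      unfolding int_f w cong_def by (simp only: power_mod flip: power_mult)
    hence "[f v ^ 4 = 1] (mod p)"
      by (metis cong_int_iff of_nat_1 of_nat_power)
    moreover have "int (f v) < int p" using p0 by (simp add: int_f)
    ultimately show ?thesis by (simp add: A_def)
  qed
  have "card A \<le> 4"
    unfolding A_def using roots_mod_prime_bound[OF p(1), of 4 1] by simp
  moreover have "card (f ` set vs) = 4"
  proof -
    have "distinct (map f vs)"
      using vs(2) int_f unfolding distinct_map inj_on_def n_def by metis
    thus ?thesis using vs(1) by (metis distinct_card length_map set_map)
  qed
  moreover have "f ` set vs \<subseteq> A" using f_A vs(3) by blast
  ultimately have "f ` set vs = A"
    by (intro card_seteq) (auto simp: A_def)
  hence "f d \<in> f ` set vs" using f_A[OF d] by simp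
  thus ?thesis unfolding cong_def n_def[symmetric] using int_f by (metis imageE)
qed

text \<open>For a prime \<open>p\<close> congruent to \<open>1\<close> modulo \<open>4\<close> the
  power \<open>(p - 1) div 4\<close> separates the classes of units modulo fourth powers, so each
  row of \<open>quads\<close> meets each of the four classes once.\<close>

definition admissible :: "nat \<Rightarrow> int \<Rightarrow> int \<Rightarrow> int \<Rightarrow> int \<Rightarrow> bool" where
  "admissible p i x y z \<longleftrightarrow> int p dvd i\<^sup>2 + 1 \<and> (\<forall>vs \<in> set (quads i x y z).
     distinct (map (\<lambda>v. v ^ ((p - 1) div 4) mod int p) vs) \<and> (\<forall>v \<in> set vs. \<not> int p dvd v))"

lemma relative_difference_family_if_admissible:
  assumes p: "prime p" "[p = 1] (mod 16)" and adm: "admissible p i x y z"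
  shows "\<exists>Bs. relative_difference_family (prime_field_add 17 \<times>\<times> prime_field_add p)
           (carrier (prime_field_add 17) \<times> {\<zero>\<^bsub>residue_ring (int p)\<^esub>}) 17 1 Bs"
proof -
  let ?F = "prime_field_add 17" and ?H = "prime_field_add p"
  let ?N = "carrier ?F \<times> {\<zero>\<^bsub>residue_ring (int p)\<^esub>}"
  have p1: "1 < p" using prime_gt_1_nat[OF p(1)] .
  have p16: "16 dvd p - 1" using p(2) p1 by (simp add: cong_altdef_nat)
  hence p4: "4 dvd p - 1" by (rule dvd_trans[rotated]) simp
  have prime17: "prime (17 :: nat)" by simp
  have i: "int p dvd i\<^sup>2 + 1" using adm by (simp add: admissible_def)
  define m where "m = (p - 1) div 16"
  obtain r where r: "\<And>d v. \<not> int p dvd d \<Longrightarrow> \<not> int p dvd v \<Longrightarrow>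
      [d ^ ((p - 1) div 4) = v ^ ((p - 1) div 4)] (mod int p) \<Longrightarrow>
      \<exists>j < m. \<exists>k. [d = i ^ k * v * r ^ j] (mod int p)"
    using quartic_coset_representatives[OF p(1) p16 i] unfolding m_def by blast
  define T where "T = template i x y z"
  define blk where "blk = (\<lambda>j. (\<lambda>(a, b). (a mod 17, r ^ j * b mod int p)) ` set T)"
  have groups: "group ?F" "group ?H"
    using group_prime_field_add prime17 p(1) by blast+
  have "relative_difference_family (?F \<times>\<times> ?H) ?N 17 1 (image_mset blk (mset_set {..<m}))"
  proof (rule relative_difference_family_if_covering)
    show "group (?F \<times>\<times> ?H)" by (rule DirProd_group[OF groups])
    show "finite (carrier (?F \<times>\<times> ?H))" by (simp add: residue_ring_def)
    have "subgroup {\<one>\<^bsub>?H\<^esub>} ?H" by (rule group.triv_subgroup[OF groups(2)])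
    thus "subgroup ?N (?F \<times>\<times> ?H)"
      using DirProd_subgroups[OF groups(1) group.subgroup_self[OF groups(1)] groups(2)] by simp
    fix B assume "B \<in># image_mset blk (mset_set {..<m})"
    then obtain j where j: "B = blk j" by auto
    \<comment> \<open>Only the upper bound is shown here; that the reduced pairs are distinct
      follows from the count in \<open>relative_difference_family_if_covering\<close>.\<close>
    have "card B \<le> card (set T)" unfolding j blk_def by (rule card_image_le) simp
    also have "\<dots> \<le> 17" using card_length[of T] by (simp add: T_def template_def)
    finally show "B \<subseteq> carrier (?F \<times>\<times> ?H) \<and> card B \<le> 17"
      using p1 by (auto simp: j blk_def residue_ring_def)
  next
    \<comment> \<open>There are \<open>17 * (p - 1)\<close> elements to cover, exactly the number of
      differences of \<open>m\<close> blocks with \<open>17 * 16\<close> differences each.\<close>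
    have "carrier (?F \<times>\<times> ?H) - ?N = {0..<17} \<times> {1..<int p}"
      by (auto simp: residue_ring_def)
    thus "size (image_mset blk (mset_set {..<m})) * (17 * (17 - 1)) \<le> card (carrier (?F \<times>\<times> ?H) - ?N)"
      using p16 by (simp add: m_def card_cartesian_product nat_diff_distrib')
  next
    fix h assume h_in: "h \<in> carrier (?F \<times>\<times> ?H) - ?N"
    obtain g d where "h = (g, d)" by (cases h)
    moreover from this h_in have "0 \<le> g" "g < 17" "0 < d" "d < int p"
      by (auto simp: residue_ring_def order.order_iff_strict)
    ultimately have h: "h = (g, d)" "0 \<le> g" "g < 17" "0 < d" "d < int p" by simp_all
    have d: "\<not> int p dvd d" using h by (auto dest: zdvd_imp_le)
    obtain vs where vs: "vs \<in> set (quads i x y z)" "\<And>v k. v \<in> set vs \<Longrightarrow> template_diff p i x y z g (i ^ k * v)"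
      using quads_template_diff[OF i] by blast
    have vs': "distinct (map (\<lambda>v. v ^ ((p - 1) div 4) mod int p) vs)" "\<And>v. v \<in> set vs \<Longrightarrow> \<not> int p dvd v"
      using adm vs(1) by (auto simp: admissible_def)
    moreover have "length vs = 4" using vs(1) by (auto simp: quads_def)
    ultimately obtain v where v: "v \<in> set vs" "[d ^ ((p - 1) div 4) = v ^ ((p - 1) div 4)] (mod int p)"
      using quartic_classes_exhaustive[OF p(1) p4 _ _ _ d] by blast
    obtain j k where jk: "j < m" "[d = i ^ k * v * r ^ j] (mod int p)"
      using r[OF d vs'(2)[OF v(1)] v(2)] by blast
    obtain a b c e where abce: "(a, b) \<in> set T" "(c, e) \<in> set T"
      "[g = a - c] (mod 17)" "[i ^ k * v = b - e] (mod int p)"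
      using vs(2)[OF v(1), of k] by (auto simp: template_diff_def T_def)
    let ?x = "(a mod 17, r ^ j * b mod int p)" and ?y = "(c mod 17, r ^ j * e mod int p)"
    have "[i ^ k * v * r ^ j = (b - e) * r ^ j] (mod int p)"
      using abce(4) by (rule cong_scalar_right)
    hence d': "[d = r ^ j * b - r ^ j * e] (mod int p)"
      using jk(2) by (metis cong_trans left_diff_distrib mult.commute)
    have "h = ?x \<otimes>\<^bsub>?F \<times>\<times> ?H\<^esub> inv\<^bsub>?F \<times>\<times> ?H\<^esub> ?y"
    proof -
      have c: "c mod 17 \<in> carrier ?F" "r ^ j * e mod int p \<in> carrier ?H"
        using p1 by (auto simp: residue_ring_def)
      have "?x \<otimes>\<^bsub>?F \<times>\<times> ?H\<^esub> inv\<^bsub>?F \<times>\<times> ?H\<^esub> ?y = ((a - c) mod 17, (r ^ j * b - r ^ j * e) mod int p)"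
        unfolding inv_DirProd[OF groups c] mult_DirProd inv_prime_field_add[OF prime17 c(1)]
          inv_prime_field_add[OF p(1) c(2)] prime_field_add_mult
        by (simp add: mod_simps)
      also have "\<dots> = (g, d)"
        using abce(3) d' h by (simp add: cong_def)
      finally show ?thesis using h by simp
    qed
    moreover have "?x \<noteq> ?y"
    proof
      assume "?x = ?y"
      hence "[r ^ j * b - r ^ j * e = 0] (mod int p)"
        by (simp add: cong_def mod_eq_dvd_iff)
      hence "[d = 0] (mod int p)" using d' by (rule cong_trans[rotated])
      thus False using d by (simp add: cong_0_iff)
    qed
    moreover have "?x \<in> blk j" "?y \<in> blk j"
      using abce(1,2) unfolding blk_def by force+
    moreover have "blk j \<in># image_mset blk (mset_set {..<m})"
      using jk(1) by simp
    ultimately show "\<exists>B x y. B \<in># image_mset blk (mset_set {..<m}) \<and> x \<in> B \<and> y \<in> B \<and> x \<noteq> y \<and>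
        h = x \<otimes>\<^bsub>?F \<times>\<times> ?H\<^esub> inv\<^bsub>?F \<times>\<times> ?H\<^esub> y"
      by blast
  qed simp
  thus ?thesis by blast
qed

subsection \<open>The listed primes\<close>

text \<open>The exponent is an integer so that its binary numeral can drive the square-and-multiply
  equations of \<open>pow_mod_code\<close>.\<close>

definition pow_mod :: "int \<Rightarrow> int \<Rightarrow> int \<Rightarrow> int" where
  "pow_mod m e v = v ^ nat e mod m"

lemma pow_mod_code [code]:
  "pow_mod m (Int.Pos num.One) v = v mod m"
  "pow_mod m (Int.Pos (num.Bit0 n)) v = pow_mod m (Int.Pos n) (v * v mod m)"
  "pow_mod m (Int.Pos (num.Bit1 n)) v = v * pow_mod m (Int.Pos n) (v * v mod m) mod m"
  by (simp_all add: pow_mod_def Int.Pos_def power_mod mod_mult_right_eq power_numeral_even power_numeral_odd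
    power_mult_distrib mult.assoc Let_def)

definition admissible_check :: "int \<Rightarrow> int \<Rightarrow> int \<Rightarrow> int \<Rightarrow> int \<Rightarrow> bool" where
  "admissible_check p i x y z \<longleftrightarrow> (i * i + 1) mod p = 0 \<and> list_all (\<lambda>vs.
     distinct (map (pow_mod p ((p - 1) div 4)) vs) \<and> list_all (\<lambda>v. v mod p \<noteq> 0) vs) (quads i x y z)"

lemma admissible_if_check:
  "admissible_check (int p) i x y z \<Longrightarrow> admissible p i x y z"
  unfolding admissible_check_def admissible_def pow_mod_def list_all_iff
  by (cases p) (simp_all add: dvd_eq_mod_eq_0 power2_eq_square nat_div_distrib)

text \<open>Entries are \<open>(p, i, x, y, z)\<close>. Together the four lists cover
  \<open>S17\<close> and the primes congruent to \<open>1\<close> modulo \<open>16\<close> in the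
  interval; each list is verified by its own evaluation.\<close>

definition witnesses_1 :: "(int \<times> int \<times> int \<times> int \<times> int) list" where
  "witnesses_1 =
    [(17, 13, 6, 2, 5), (881, 387, 222, 219, 163), (1297, 1261, 258, 622, 164),
     (1601, 1561, 71, 194, 431), (1873, 737, 159, 813, 80), (2017, 229, 181, 530, 329),
     (2129, 372, 77, 267, 785), (2657, 2494, 147, 590, 888), (2753, 1959, 525, 344, 490),
     (2801, 1258, 538, 851, 877), (2897, 1777, 369, 1443, 448), (3089, 2696, 288, 1443, 923),
     (3121, 79, 209, 874, 101), (3217, 1781, 606, 365, 467), (3313, 2906, 248, 1069, 1046),
     (3361, 900, 262, 523, 351), (3617, 1234, 66, 1047, 48), (3697, 1131, 879, 1105, 85),
     (3761, 604, 73, 621, 1639), (3793, 803, 269, 294, 567), (3889, 454, 274, 1028, 198),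
     (4001, 3102, 146, 1776, 1122), (4049, 884, 68, 1367, 1513), (4129, 3234, 638, 120, 1941)]"

lemma witnesses_1_admissible: "list_all (\<lambda>(p, i, x, y, z). admissible_check p i x y z) witnesses_1"
  by code_simp

definition witnesses_2 :: "(int \<times> int \<times> int \<times> int \<times> int) list" where
  "witnesses_2 =
    [(4241, 1044, 434, 189, 417), (4273, 1200, 226, 1157, 593), (4289, 3761, 11, 1825, 2099),
     (4481, 276, 30, 425, 1464), (4561, 2356, 773, 1986, 358), (4657, 1912, 553, 104, 2261),
     (4721, 1697, 369, 1186, 1317), (4801, 3398, 184, 1131, 2392), (4817, 1291, 34, 1298, 2241),
     (4993, 158, 12, 284, 172), (5009, 4470, 411, 1034, 1791), (5233, 2253, 76, 1547, 1466),
     (5281, 1673, 231, 387, 1576), (5297, 2313, 24, 2310, 1615), (5393, 665, 233, 560, 190),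
     (5441, 2452, 59, 1677, 2076), (5521, 4756, 123, 1147, 1428), (5569, 973, 74, 147, 2017),
     (5857, 4547, 838, 2581, 1668), (5953, 3550, 275, 8, 2412), (6113, 5024, 124, 1654, 1805),
     (6257, 1584, 946, 3034, 1728), (6337, 178, 39, 1400, 1118), (6449, 1854, 76, 2724, 410)]"

lemma witnesses_2_admissible: "list_all (\<lambda>(p, i, x, y, z). admissible_check p i x y z) witnesses_2"
  by code_simp

definition witnesses_3 :: "(int \<times> int \<times> int \<times> int \<times> int) list" where
  "witnesses_3 =
    [(6529, 4218, 91, 2933, 2796), (6673, 4236, 292, 700, 559), (6689, 3930, 46, 2082, 2431),
     (6737, 4344, 183, 2479, 1308), (6833, 1307, 70, 2512, 2720), (6961, 344, 453, 644, 1497),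
     (6977, 2063, 57, 1070, 2512), (7057, 6973, 86, 339, 2992), (7121, 6343, 475, 3283, 2700),
     (7297, 3553, 461, 3577, 1109), (7393, 2361, 260, 3276, 3348), (7457, 1275, 330, 3048, 178),
     (7489, 5898, 56, 3196, 3094), (7537, 6488, 57, 1709, 2876), (7649, 5286, 376, 2176, 280),
     (7681, 3383, 535, 798, 1420), (7793, 2214, 20, 3798, 349), (7841, 198, 23, 3361, 2981),
     (7873, 3590, 504, 1588, 3162), (7937, 1962, 276, 3325, 3694), (8017, 6204, 114, 510, 2634),
     (8081, 3940, 228, 693, 2240), (8161, 7959, 95, 1081, 2262), (8209, 6270, 45, 129, 4075)]"

lemma witnesses_3_admissible: "list_all (\<lambda>(p, i, x, y, z). admissible_check p i x y z) witnesses_3"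
  by code_simp

definition witnesses_4 :: "(int \<times> int \<times> int \<times> int \<times> int) list" where
  "witnesses_4 =
    [(8273, 2162, 14, 72, 1481), (8353, 2688, 604, 508, 321), (8369, 666, 55, 2702, 1591),
     (8513, 7310, 44, 1093, 1474), (8609, 1830, 36, 439, 92), (8641, 7058, 555, 3427, 287),
     (8689, 4628, 334, 1933, 3002), (8737, 4473, 254, 596, 4239), (8753, 2569, 177, 4276, 385),
     (8849, 2994, 93, 4021, 3489), (8929, 3424, 276, 424, 3300), (9041, 6757, 418, 3066, 2234),
     (9137, 7851, 10, 25, 1519), (9281, 8695, 68, 4034, 2811), (9377, 6529, 233, 1884, 850),
     (9473, 1172, 24, 177, 3521), (9521, 2140, 42, 529, 73), (9601, 9197, 155, 254, 2108),
     (9649, 845, 28, 2719, 1423), (9697, 1557, 47, 2263, 3602), (9857, 222, 218, 4803, 4412)]"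

lemma witnesses_4_admissible: "list_all (\<lambda>(p, i, x, y, z). admissible_check p i x y z) witnesses_4"
  by code_simp

definition witnesses :: "(int \<times> int \<times> int \<times> int \<times> int) list" where
  "witnesses = witnesses_1 @ witnesses_2 @ witnesses_3 @ witnesses_4"

lemmas witnesses_defs = witnesses_def witnesses_1_def witnesses_2_def witnesses_3_def witnesses_4_def

lemma witness_admissible:
  assumes "int p \<in> fst ` set witnesses"
  shows "\<exists>i x y z. admissible p i x y z"
proof -
  obtain i x y z where "(int p, i, x, y, z) \<in> set witnesses" using assms by force
  moreover have "list_all (\<lambda>(p, i, x, y, z). admissible_check p i x y z) witnesses"
    by (simp only: witnesses_def list_all_append witnesses_1_admissible witnesses_2_admissible
      witnesses_3_admissible witnesses_4_admissible simp_thms)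
  ultimately show ?thesis
    unfolding list_all_iff using admissible_if_check by fast
qed

lemma S17_witnesses: "int ` S17 \<subseteq> fst ` set witnesses"
  by (simp add: S17_def witnesses_defs)

text \<open>The list gives a prime factor of \<open>16 k + 1\<close> for \<open>417 \<le> k \<le> 616\<close>, and \<open>0\<close> where \<open>16 k + 1\<close> is prime.\<close>

definition factors :: "int list" where "factors =
     [0, 0, 3, 11, 0, 3, 7, 5, 3, 17, 0, 3, 5, 7, 3, 31, 13, 3, 0, 0, 3, 43, 5, 3, 0, 11, 3, 5, 0, 3,
      23, 67, 3, 19, 7, 3, 11, 5, 3, 0, 71, 3, 5, 17, 3, 0, 31, 3, 7, 0, 3, 0, 5, 3, 0, 7, 3, 5, 11,
      3, 17, 0, 3, 0, 43, 3, 59, 5, 3, 7, 0, 3, 5, 0, 3, 0, 7, 3, 89, 0, 3, 13, 5, 3, 0, 29, 3, 5, 0,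
      3, 7, 11, 3, 0, 13, 3, 0, 5, 3, 23, 0, 3, 5, 53, 3, 0, 0, 3, 31, 19, 3, 7, 5, 3, 29, 0, 3, 5,
      7, 3, 13, 0, 3, 0, 11, 3, 0, 5, 3, 0, 0, 3, 5, 13, 3, 11, 0, 3, 83, 7, 3, 0, 5, 3, 47, 17, 3,
      5, 0, 3, 43, 61, 3, 7, 0, 3, 53, 5, 3, 13, 7, 3, 5, 0, 3, 67, 19, 3, 11, 0, 3, 97, 5, 3, 7, 0,
      3, 5, 0, 3, 41, 7, 3, 0, 59, 3, 0, 5, 3, 0, 11, 3, 5, 43, 3, 7, 17, 3, 13, 0]"

lemma length_factors: "length factors = 200"
  by (simp add: factors_def)

lemma factors: "list_all (\<lambda>(r, k). if r = 0 then 16 * k + 1 \<in> set (map fst witnesses)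
    else 1 < r \<and> r < 100 \<and> (16 * k + 1) mod r = 0) (zip factors [417..616])"
  by code_simp

lemma primes_in_range_witnesses:
  fixes q :: nat
  assumes "prime q" "[q = 1] (mod 16)" "6673 \<le> q" "q \<le> 9857"
  shows "int q \<in> fst ` set witnesses"
proof -
  define k where "k = int q div 16"
  have "int q mod 16 = 1"
    using assms(2) by (simp add: cong_def flip: of_nat_mod) presburger
  hence q: "int q = 16 * k + 1" unfolding k_def by presburger
  have k: "417 \<le> k" "k \<le> 616" using assms(3,4) q by simp_all
  define r where "r = factors ! nat (k - 417)"
  have j: "nat (k - 417) < 200" using k by simp
  have len: "length [417..616 :: int] = 200" by (simp only: length_upto)
  have "[417..616] ! nat (k - 417) = 417 + int (nat (k - 417))"
    by (rule nth_upto) (use k in simp)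
  also have "\<dots> = k" using k by simp
  finally have "zip factors [417..616] ! nat (k - 417) = (r, k)"
    unfolding r_def using j by (subst nth_zip) (simp_all only: length_factors len)
  moreover have "nat (k - 417) < length (zip factors [417..616])"
    using j by (simp only: length_zip length_factors len)
  ultimately have "(r, k) \<in> set (zip factors [417..616])" by (metis nth_mem)
  hence "if r = 0 then int q \<in> set (map fst witnesses) else 1 < r \<and> r < 100 \<and> int q mod r = 0"
    using factors unfolding list_all_iff q by fast
  \<comment> \<open>A factor below \<open>100\<close> would be a proper one, as
    \<open>6673 \<le> q\<close>.\<close>
  moreover have False if "1 < r" "r < 100" "int q mod r = 0"
  proof -
    have "int (nat r) dvd int q" using that by (simp add: dvd_eq_mod_eq_0)
    hence "nat r = 1 \<or> nat r = q" using assms(1) by (simp only: int_dvd_int_iff prime_nat_iff)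
    thus False using that(1,2) assms(3) by auto
  qed
  ultimately show ?thesis by (auto split: if_splits)
qed

lemma small_primes_admissible:
  fixes q :: nat
  assumes "prime q" "[q = 1] (mod 16)" "q \<in> S17 \<or> 6673 \<le> q \<and> q \<le> 9857"
  shows "\<exists>i x y z. admissible q i x y z"
  using assms S17_witnesses primes_in_range_witnesses witness_admissible by blast

subsection \<open>Stepanov's method\<close>

text \<open>Taylor expansion at \<open>z\<close>: the \<open>l\<close>-th derivative is
  \<open>fact l\<close> times the \<open>l\<close>-th coefficient, and \<open>fact l\<close> is
  nonzero in the field because \<open>l < CHAR('a)\<close>.\<close>

lemma linear_power_dvd_if_higher_pderiv_zero:
  fixes p :: "'a::idom_prime_char poly"
  assumes zero: "\<And>l. l < M \<Longrightarrow> poly ((pderiv ^^ l) p) z = 0" and M: "M \<le> CHAR('a)"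
  shows "[:- z, 1:] ^ M dvd p"
proof -
  have shift: "(pderiv ^^ l) (p \<circ>\<^sub>p [:z, 1:]) = ((pderiv ^^ l) p) \<circ>\<^sub>p [:z, 1:]" for l
    by (induction l) (simp_all add: pderiv_pcompose pderiv_pCons)
  have "coeff (p \<circ>\<^sub>p [:z, 1:]) l = 0" if l: "l < M" for l
  proof -
    have fact_eq: "of_nat (fact l) = pochhammer (1 :: 'a) l"
      by (metis of_nat_1 pochhammer_fact pochhammer_of_nat of_nat_id)
    have "of_nat (fact l) * coeff (p \<circ>\<^sub>p [:z, 1:]) l = coeff ((pderiv ^^ l) (p \<circ>\<^sub>p [:z, 1:])) 0"
      by (simp add: coeff_higher_pderiv fact_eq)
    also have "\<dots> = poly ((pderiv ^^ l) p \<circ>\<^sub>p [:z, 1:]) 0"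
      by (simp only: shift poly_0_coeff_0)
    also have "\<dots> = 0"
      using zero[OF l] by (simp add: poly_pcompose)
    finally have "of_nat (fact l) * coeff (p \<circ>\<^sub>p [:z, 1:]) l = 0" .
    moreover have "\<not> CHAR('a) dvd fact l"
      using l M by (subst prime_dvd_fact_iff) auto
    hence "of_nat (fact l) \<noteq> (0 :: 'a)"
      by (simp add: of_nat_eq_0_iff_char_dvd)
    ultimately show ?thesis by simp
  qed
  hence "monom 1 M dvd p \<circ>\<^sub>p [:z, 1:]"
    by (simp add: monom_1_dvd_iff')
  then obtain r where r: "p \<circ>\<^sub>p [:z, 1:] = monom 1 M * r" ..
  have "p = (p \<circ>\<^sub>p [:z, 1:]) \<circ>\<^sub>p [:- z, 1:]"
    by (simp add: pcompose_assoc[symmetric] pcompose_pCons)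
  also have "\<dots> = [:- z, 1:] ^ M * (r \<circ>\<^sub>p [:- z, 1:])"
    unfolding r pcompose_mult by (simp add: monom_altdef pcompose_hom.hom_power pcompose_pCons)
  finally show ?thesis by simp
qed

text \<open>Pigeonhole: over a finite ring there are more vectors indexed by \<open>J\<close> than
  values indexed by \<open>I\<close>, so two vectors have the same image and their difference is a
  solution.\<close>

lemma homogeneous_system_nontrivial_solution:
  fixes A :: "'i \<Rightarrow> 'j \<Rightarrow> 'a::{finite, comm_ring_1}"
  assumes I: "finite I" and J: "finite J" and less: "card I < card J"
  shows "\<exists>x. (\<exists>j\<in>J. x j \<noteq> 0) \<and> (\<forall>i\<in>I. (\<Sum>j\<in>J. x j * A i j) = 0)"
proof -
  define F where "F = (\<lambda>x. \<lambda>i\<in>I. \<Sum>j\<in>J. x j * A i j)"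
  have one_less: "1 < CARD('a)"
  proof -
    have "card {0, 1 :: 'a} \<le> CARD('a)" by (intro card_mono) auto
    thus ?thesis by simp
  qed
  have "card (PiE I (\<lambda>_. UNIV :: 'a set)) < card (PiE J (\<lambda>_. UNIV :: 'a set))"
    using I J less one_less by (simp add: card_PiE)
  moreover have "F ` PiE J (\<lambda>_. UNIV) \<subseteq> PiE I (\<lambda>_. UNIV)"
    by (auto simp: F_def)
  ultimately have "\<not> inj_on F (PiE J (\<lambda>_. UNIV))"
    using I by (metis card_inj_on_le finite_PiE finite leD)
  then obtain x y where xy: "x \<in> PiE J (\<lambda>_. UNIV)" "y \<in> PiE J (\<lambda>_. UNIV)" "F x = F y" "x \<noteq> y"
    unfolding inj_on_def by blast
  obtain j where "j \<in> J" "x j \<noteq> y j"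
    using xy by (metis PiE_ext)
  moreover have "(\<Sum>j\<in>J. (x j - y j) * A i j) = 0" if "i \<in> I" for i
    using fun_cong[OF xy(3), of i] that by (simp add: F_def algebra_simps sum_subtractf)
  ultimately show ?thesis
    by (intro exI[of _ "\<lambda>j. x j - y j"]) auto
qed

text \<open>The logarithmic derivative \<open>\<Sum>c\<in>C. n c / (X - c)\<close> with its
  denominators cleared.\<close>

lemma pderiv_prod_linear_powers:
  fixes C :: "'a::idom set"
  assumes "finite C"
  shows "pderiv (\<Prod>c\<in>C. [:- c, 1:] ^ n c) * (\<Prod>c\<in>C. [:- c, 1:]) =
    (\<Prod>c\<in>C. [:- c, 1:] ^ n c) * (\<Sum>c\<in>C. smult (of_nat (n c)) (\<Prod>c'\<in>C - {c}. [:- c', 1:]))"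
proof -
  let ?L = "\<lambda>c :: 'a. [:- c, 1:]"
  have "(\<Prod>c'\<in>C - {c}. ?L c' ^ n c') * pderiv (?L c ^ n c) * (\<Prod>c\<in>C. ?L c) =
        (\<Prod>c\<in>C. ?L c ^ n c) * smult (of_nat (n c)) (\<Prod>c'\<in>C - {c}. ?L c')" if c: "c \<in> C" for c
  proof (cases "n c")
    case (Suc k)
    have gen: "Q * X * (L * R) = L' * Q * smult k R"
      if "X * L = smult k L'" for Q X L R L' :: "'a poly" and k
    proof -
      have "Q * X * (L * R) = Q * R * (X * L)" by (simp only: mult_ac)
      also have "\<dots> = L' * Q * smult k R" unfolding that by (simp add: mult_ac)
      finally show ?thesis .
    qed
    have "pderiv (?L c ^ n c) * ?L c = smult (of_nat (n c)) (?L c ^ n c)"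
      unfolding Suc pderiv_power_Suc by (simp add: pderiv_pCons smult_diff_right mult_ac)
    moreover have "(\<Prod>c\<in>C. ?L c) = ?L c * (\<Prod>c'\<in>C - {c}. ?L c')"
      "(\<Prod>c\<in>C. ?L c ^ n c) = ?L c ^ n c * (\<Prod>c'\<in>C - {c}. ?L c' ^ n c')"
      using assms c by (simp_all only: prod.remove)
    ultimately show ?thesis
      by (simp only: gen)
  qed simp
  thus ?thesis
    by (simp add: pderiv_prod sum_distrib_right sum_distrib_left)
qed

text \<open>If \<open>g' / g = u / h\<close>, the \<open>l\<close>-th derivative of
  \<open>p * g\<close> is \<open>g / h ^ l\<close> times a polynomial; the recursion for that
  polynomial is the quotient rule.\<close>

primrec deriv_cofactor :: "'a::idom poly \<Rightarrow> 'a poly \<Rightarrow> nat \<Rightarrow> 'a poly \<Rightarrow> 'a poly" where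
  "deriv_cofactor h u 0 p = p"
| "deriv_cofactor h u (Suc l) p =
     h * pderiv (deriv_cofactor h u l p) + deriv_cofactor h u l p * (u - of_nat l * pderiv h)"

lemma deriv_cofactor:
  assumes "pderiv g * h = g * u"
  shows "h ^ l * (pderiv ^^ l) (p * g) = deriv_cofactor h u l p * g"
proof (induction l)
  case (Suc l)
  let ?D = "(pderiv ^^ l) (p * g)" and ?P = "deriv_cofactor h u l p"
  have "h * pderiv (h ^ l * ?D) = h * (h ^ l * pderiv ?D) + of_nat l * pderiv h * (h ^ l * ?D)"
  proof (cases l)
    case (Suc k)
    have "pderiv (h ^ l) = of_nat l * h ^ k * pderiv h"
      unfolding Suc pderiv_power_Suc by (simp add: of_nat_poly)
    thus ?thesis unfolding pderiv_mult by (simp add: Suc algebra_simps)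
  qed simp
  also have "h * (h ^ l * pderiv ?D) = h ^ Suc l * (pderiv ^^ Suc l) (p * g)"
    by (simp add: mult_ac)
  finally have "h ^ Suc l * (pderiv ^^ Suc l) (p * g) =
      h * pderiv (?P * g) - of_nat l * pderiv h * (?P * g)"
    unfolding Suc.IH by simp
  also have "h * pderiv (?P * g) = h * pderiv ?P * g + ?P * (pderiv g * h)"
    by (simp add: pderiv_mult algebra_simps)
  finally show ?case
    unfolding assms by (simp add: algebra_simps)
qed simp

text \<open>The bound does not involve the degree of \<open>g\<close>. This keeps the number of
  linear equations in Stepanov's method small although \<open>g\<close> has large degree.\<close>

lemma degree_deriv_cofactor_le:
  assumes "degree h \<le> m" "degree u \<le> m"
  shows "degree (deriv_cofactor h u l p) \<le> degree p + l * m"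
proof (induction l)
  case (Suc l)
  let ?P = "deriv_cofactor h u l p"
  have "degree (h * pderiv ?P) \<le> m + degree ?P"
    using degree_mult_le[of h "pderiv ?P"] assms degree_pderiv_le[of ?P] by linarith
  moreover have "degree (of_nat l * pderiv h) \<le> m"
    using degree_mult_le[of "of_nat l" "pderiv h"] assms degree_pderiv_le[of h] by simp
  hence "degree (u - of_nat l * pderiv h) \<le> m"
    using assms by (intro degree_diff_le) auto
  hence "degree (?P * (u - of_nat l * pderiv h)) \<le> m + degree ?P"
    using degree_mult_le[of ?P "u - of_nat l * pderiv h"] by linarith
  ultimately have "degree (deriv_cofactor h u (Suc l) p) \<le> m + degree ?P"
    by (auto intro: degree_add_le)
  thus ?case using Suc by simp
qed simp

lemma finite_field_power_card_minus_one:
  fixes u :: "'a::finite_field"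
  assumes "u \<noteq> 0"
  shows "u ^ (CARD('a) - 1) = 1"
proof -
  have "u * u ^ (CARD('a) - 1) = u ^ CARD('a)"
    using finite_UNIV_card_ge_0[where ?'a = 'a] by (cases "CARD('a)") simp_all
  also have "\<dots> = u" by (rule finite_field_power_card_eq_same)
  finally show ?thesis using assms by simp
qed

text \<open>A nonzero polynomial of degree at most \<open>(K + card C) * q\<close> is made to vanish
  to order \<open>M\<close> at every counted \<open>z\<close>. With
  \<open>D = (q - 1) div d\<close>, the hypothesis \<open>less\<close> says that
  \<open>M * (D + K + M * card C)\<close> linear equations are fewer than the
  \<open>K * (q - 1)\<close> unknowns; coprimality of \<open>a 0\<close> and \<open>d\<close> keeps
  the polynomial nonzero.\<close>

theorem stepanov_bound:
  fixes C :: "'a::finite_field set" and a :: "'a \<Rightarrow> nat"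
  defines "q \<equiv> CARD('a)"
  assumes prime: "CHAR('a) = q" and C: "0 \<in> C" and d: "d dvd q - 1" and a: "coprime (a 0) d"
    and M: "0 < M" "M \<le> q"
    and less: "M * ((q - 1) div d + K + M * card C) < K * (q - 1)"
  shows "M * card {z \<in> - C. (\<Prod>c\<in>C. (z - c) ^ (a c * ((q - 1) div d))) = \<epsilon>} \<le> (K + card C) * q"
proof -
  define D where "D = (q - 1) div d"
  define Z where "Z = {z \<in> - C. (\<Prod>c\<in>C. (z - c) ^ (a c * D)) = \<epsilon>}"
  define m where "m = card C"
  have finC: "finite C" by simp
  have dD: "d * D = q - 1" using d by (simp add: D_def)
  have K0: "0 < K" using less by (cases K) auto
  have q1: "1 < q" using less by (cases "q > 1") auto
  have d0: "0 < d" using dD q1 by (cases d) auto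
  have D0: "0 < D" using dD q1 by (cases D) auto
  \<comment> \<open>Reducing \<open>e * a c\<close> modulo \<open>d\<close> keeps the exponent below
    \<open>q\<close> and preserves the values outside \<open>C\<close>, since
    \<open>d * D = q - 1\<close>.\<close>
  define b where "b = (\<lambda>e c. (e * a c) mod d * D)"
  have b_le: "b e c + D \<le> q - 1" for e c
  proof -
    have "Suc ((e * a c) mod d) * D \<le> d * D"
      using d0 by (intro mult_right_mono) (auto simp: Suc_le_eq)
    thus ?thesis by (simp add: b_def dD)
  qed
  \<comment> \<open>The additional factor \<open>X ^ (k * q)\<close> takes the value
    \<open>z ^ k\<close> by \<open>z ^ q = z\<close>: it supplies new polynomials of high degree
    that look like low degree ones on the field.\<close>
  define n where "n = (\<lambda>e k c. b e c + (if c = 0 then k * q else 0))"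
  define h where "h = (\<Prod>c\<in>C. [:- c, 1:])"
  define G where "G = (\<lambda>e k. \<Prod>c\<in>C. [:- c, 1:] ^ n e k c)"
  define u where "u = (\<lambda>e k. \<Sum>c\<in>C. smult (of_nat (n e k c)) (\<Prod>c'\<in>C - {c}. [:- c', 1:]))"
  \<comment> \<open>The auxiliary polynomial is a linear combination of the \<open>T (e, k, i)\<close>. Since \<open>G e k\<close> takes the value
    \<open>\<epsilon>\<^sup>e z\<^sup>k\<close> on \<open>Z\<close>, its \<open>l\<close>-th derivative agrees there, up to the factor \<open>h\<^sup>l\<close>, with the same combination
    of the low degree polynomials \<open>W l (e, k, i)\<close>, which a linear system makes vanish.\<close>
  define T where "T = (\<lambda>(e, k, i). monom 1 i * G e k)"
  define P where "P = (\<lambda>l (e, k, i). deriv_cofactor h (u e k) l (monom 1 i))"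
  define W where "W = (\<lambda>l j. case j of (e, k, i) \<Rightarrow> smult (\<epsilon> ^ e) (monom 1 k) * P l j)"
  define J where "J = {..<d} \<times> {..<K} \<times> {..<D}"
  define B where "B = D + K + M * m"
  define I where "I = {..<M} \<times> {..<B}"

  \<comment> \<open>Derivatives and their degrees\<close>
  have derivs: "h ^ l * (pderiv ^^ l) (T (e, k, i)) = P l (e, k, i) * G e k" for l e k i
    unfolding T_def P_def prod.case
    by (rule deriv_cofactor) (simp add: G_def h_def u_def pderiv_prod_linear_powers)
  have degree_h: "degree h \<le> m"
    unfolding h_def m_def using degree_prod_sum_le[OF finC, of "\<lambda>c. [:- c, 1:]"] by simp
  have degree_u: "degree (u e k) \<le> m" for e k
    unfolding u_def
  proof (rule degree_sum_le[OF finC])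
    fix c assume "c \<in> C"
    have "degree (\<Prod>c'\<in>C - {c}. [:- c', 1:]) \<le> card (C - {c})"
      using degree_prod_sum_le[of "C - {c}" "\<lambda>c. [:- c, 1:]"] by simp
    also have "\<dots> \<le> m" unfolding m_def by (intro card_mono) auto
    finally show "degree (smult (of_nat (n e k c)) (\<Prod>c'\<in>C - {c}. [:- c', 1:])) \<le> m"
      using degree_smult_le le_trans by blast
  qed
  have degree_W: "degree (W l j) < B" if "l < M" "j \<in> J" for l j
  proof -
    obtain e k i where j: "j = (e, k, i)" by (cases j)
    have "degree (W l j) \<le> degree (smult (\<epsilon> ^ e) (monom 1 k)) + degree (P l j)"
      unfolding W_def j prod.case by (rule degree_mult_le)
    also have "degree (smult (\<epsilon> ^ e) (monom 1 k)) \<le> k"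
      by (rule order_trans[OF degree_smult_le degree_monom_le])
    also have "degree (P l j) \<le> degree (monom (1 :: 'a) i) + l * m"
      unfolding P_def j prod.case by (rule degree_deriv_cofactor_le[OF degree_h degree_u])
    also have "\<dots> \<le> i + l * m"
      by (intro add_right_mono degree_monom_le)
    also have "k + (i + l * m) < K + (D + M * m)"
      using that by (intro add_strict_mono add_less_le_mono mult_right_mono) (auto simp: J_def j)
    finally show ?thesis by (simp add: B_def)
  qed

  \<comment> \<open>The linear system\<close>
  have "card I = M * (D + K + M * m)"
    by (simp add: I_def B_def)
  also have "\<dots> < K * (q - 1)" using less by (simp add: D_def m_def)
  also have "\<dots> = card J" by (simp only: J_def dD[symmetric] card_cartesian_product card_lessThan mult_ac)
  finally have "card I < card J" .
  then obtain x where x: "\<exists>j\<in>J. x j \<noteq> 0"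
      and eqs: "\<And>l r. (l, r) \<in> I \<Longrightarrow> (\<Sum>j\<in>J. x j * coeff (W l j) r) = 0"
    using homogeneous_system_nontrivial_solution[of I J "\<lambda>(l, r) j. coeff (W l j) r"]
    by (force simp: I_def J_def)
  have W_sum: "(\<Sum>j\<in>J. smult (x j) (W l j)) = 0" if "l < M" for l
  proof (rule poly_eqI)
    fix r
    show "coeff (\<Sum>j\<in>J. smult (x j) (W l j)) r = coeff 0 r"
    proof (cases "r < B")
      case True
      thus ?thesis using eqs[of l r] that by (simp add: coeff_sum I_def)
    next
      case False
      thus ?thesis
        using degree_W[OF that] by (force simp: coeff_sum intro!: sum.neutral coeff_eq_0)
    qed
  qed

  \<comment> \<open>The auxiliary polynomial and its nonvanishing\<close>
  define R where "R = (\<Sum>j\<in>J. smult (x j) (T j))"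

  \<comment> \<open>The \<open>T j\<close> have distinct orders \<open>N j\<close> of vanishing at \<open>0\<close>, so they are linearly independent.\<close>
  define N where "N = (\<lambda>(e, k, i). i + b e 0 + k * q)"
  have inj_N: "inj_on N J"
  proof (rule inj_onI)
    fix j j' assume J': "j \<in> J" "j' \<in> J" and eq: "N j = N j'"
    obtain e k i e' k' i' where j: "j = (e, k, i)" "j' = (e', k', i')"
      by (cases j, cases j')
    have bounds: "e < d" "e' < d" "i < D" "i' < D" using J' by (auto simp: J_def j)
    have small: "i + b e 0 < q" "i' + b e' 0 < q"
      using b_le[of e 0] b_le[of e' 0] bounds q1 by linarith+
    have "(i + b e 0 + k * q) div q = (i' + b e' 0 + k' * q) div q"
      "(i + b e 0 + k * q) mod q = (i' + b e' 0 + k' * q) mod q"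
      using eq by (simp_all add: N_def j)
    hence k: "k = k'" and r: "i + b e 0 = i' + b e' 0"
      using small q1 by simp_all
    \<comment> \<open>\<open>N\<close> is a mixed radix expansion with digits \<open>i < D\<close>,
      \<open>(e * a 0) mod d\<close> and \<open>k\<close>; the middle digit determines
      \<open>e\<close> because \<open>a 0\<close> is invertible modulo \<open>d\<close>.\<close>
    have "(i + b e 0) div D = (i' + b e' 0) div D" "(i + b e 0) mod D = (i' + b e' 0) mod D"
      using r by simp_all
    hence "(e * a 0) mod d = (e' * a 0) mod d" and i: "i = i'"
      using bounds by (simp_all add: b_def)
    hence "[e = e'] (mod d)"
      using a by (metis cong_def cong_mult_rcancel_nat)
    hence "e = e'" using bounds by (simp add: cong_def)
    thus "j = j'" by (simp add: j k i)
  qed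
  have T_eq: "T j = monom 1 (N j) * (\<Prod>c\<in>C - {0}. [:- c, 1:] ^ b (fst j) c)" for j
  proof -
    obtain e k i where j: "j = (e, k, i)" by (cases j)
    have "G e k = [:0, 1:] ^ (b e 0 + k * q) * (\<Prod>c\<in>C - {0}. [:- c, 1:] ^ n e k c)"
      unfolding G_def by (subst prod.remove[OF finC C]) (simp add: n_def)
    also have "(\<Prod>c\<in>C - {0}. [:- c, 1:] ^ n e k c) = (\<Prod>c\<in>C - {0}. [:- c, 1:] ^ b e c)"
      by (intro prod.cong) (auto simp: n_def)
    also have "[:0, 1:] ^ (b e 0 + k * q) = monom (1 :: 'a) (b e 0 + k * q)"
      by (simp add: monom_altdef)
    finally show ?thesis
      by (simp add: T_def N_def j mult_monom add_ac flip: mult.assoc)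
  qed

  have "R \<noteq> 0"
  proof -
    let ?J = "{j \<in> J. x j \<noteq> 0}"
    \<comment> \<open>The term of least order at \<open>0\<close> among those with nonzero
      coefficient cannot be cancelled by the others.\<close>
    obtain j where j: "j \<in> J" "x j \<noteq> 0" and min: "\<And>j'. j' \<in> ?J \<Longrightarrow> N j \<le> N j'"
    proof -
      obtain j0 where "j0 \<in> ?J" using x by blast
      from ex_has_least_nat[of "\<lambda>j. j \<in> ?J", OF this, of N] that show ?thesis by blast
    qed
    let ?H = "\<Prod>c\<in>C - {0}. [:- c, 1:] ^ b (fst j) c"
    have "coeff R (N j) = (\<Sum>j'\<in>J. x j' * coeff (T j') (N j))"
      by (simp add: R_def coeff_sum)
    also have "\<dots> = (\<Sum>j'\<in>{j}. x j' * coeff (T j') (N j))"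
    proof (rule sum.mono_neutral_right)
      show "\<forall>j'\<in>J - {j}. x j' * coeff (T j') (N j) = 0"
      proof
        fix j' assume j': "j' \<in> J - {j}"
        show "x j' * coeff (T j') (N j) = 0"
        proof (cases "x j' = 0")
          case False
          hence "N j \<le> N j'" using min j' by simp
          moreover have "N j \<noteq> N j'" using inj_N j j' by (auto simp: inj_on_def)
          ultimately have "coeff (T j') (N j) = 0"
            unfolding T_eq by (simp add: coeff_monom_mult)
          thus ?thesis by simp
        qed simp
      qed
    qed (use j in \<open>auto simp: J_def\<close>)
    also have "\<dots> = x j * poly ?H 0"
      by (simp add: T_eq coeff_monom_mult poly_0_coeff_0)
    also have "poly ?H 0 \<noteq> 0"
      by (simp add: poly_prod)
    hence "x j * poly ?H 0 \<noteq> 0" using j by simp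
    finally show ?thesis by auto
  qed

  \<comment> \<open>Degree of the auxiliary polynomial\<close>
  have degree_T: "degree (T j) \<le> (K + m) * q" if "j \<in> J" for j
  proof -
    obtain e k i where j: "j = (e, k, i)" by (cases j)
    have "degree (\<Prod>c\<in>C - {0}. [:- c, 1:] ^ b e c) \<le> (\<Sum>c\<in>C - {0}. b e c)"
      by (rule order_trans[OF degree_prod_sum_le]) (auto simp: degree_power_eq)
    also have "\<dots> \<le> (\<Sum>c\<in>C - {0}. q)"
      using b_le by (intro sum_mono) (metis add_leD1 diff_le_self order_trans)
    also have "\<dots> = (m - 1) * q" using C by (simp add: m_def)
    finally have "degree (T j) \<le> N j + (m - 1) * q"
      unfolding T_eq j
      by (intro order_trans[OF degree_mult_le] add_mono order_trans[OF degree_monom_le]) auto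
    also have "N j \<le> K * q"
    proof -
      have "i < D" "k < K" using that by (auto simp: J_def j)
      have "N j \<le> q + k * q"
        using b_le[of e 0] \<open>i < D\<close> by (simp add: N_def j)
      also have "\<dots> = Suc k * q" by simp
      also have "\<dots> \<le> K * q" using \<open>k < K\<close> by (intro mult_right_mono) auto
      finally show ?thesis .
    qed
    also have "K * q + (m - 1) * q \<le> (K + m) * q"
      by (simp add: algebra_simps diff_mult_distrib)
    finally show ?thesis by simp
  qed
  have degree_R: "degree R \<le> (K + m) * q"
    unfolding R_def
  proof (rule degree_sum_le)
    show "degree (smult (x j) (T j)) \<le> (K + m) * q" if "j \<in> J" for j
      by (rule order_trans[OF degree_smult_le degree_T[OF that]])
  qed (simp add: J_def)

  \<comment> \<open>Order of vanishing at the counted points\<close>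
  have order_R: "M \<le> order z R" if z: "z \<in> Z" for z
  proof -
    have zC: "z \<notin> C" and \<epsilon>: "\<epsilon> = (\<Prod>c\<in>C. (z - c) ^ (a c * D))"
      using z by (auto simp: Z_def)
    have G_z: "poly (G e k) z = \<epsilon> ^ e * z ^ k" for e k
    proof -
      have "(z - c) ^ (a c * D * e) = (z - c) ^ b e c" if "c \<in> C" for c
      proof -
        have "a c * D * e = (e * a c) div d * d * D + (e * a c) mod d * D"
          by (metis (no_types, opaque_lifting) div_mult_mod_eq distrib_right mult.assoc mult.commute)
        also have "\<dots> = (q - 1) * ((e * a c) div d) + b e c"
          by (simp only: b_def dD[symmetric] mult_ac)
        finally have "(z - c) ^ (a c * D * e) = ((z - c) ^ (q - 1)) ^ ((e * a c) div d) * (z - c) ^ b e c"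
          by (simp add: power_add power_mult)
        moreover have "(z - c) ^ (q - 1) = 1" 
          unfolding q_def using that zC by (intro finite_field_power_card_minus_one) auto
        ultimately show ?thesis by (simp only: power_one mult_1)
      qed
      hence "\<epsilon> ^ e = (\<Prod>c\<in>C. (z - c) ^ b e c)"
        unfolding \<epsilon> prod_power_distrib by (simp flip: power_mult)
      moreover have "poly (G e k) z = (\<Prod>c\<in>C. (z - c) ^ b e c * (if c = 0 then (z ^ q) ^ k else 1))"
        unfolding G_def poly_prod by (intro prod.cong) (auto simp: n_def power_add power_mult[symmetric] mult_ac)
      moreover have "(\<Prod>c\<in>C. if c = 0 then (z ^ q) ^ k else 1) = z ^ k"
        using C finite_field_power_card_eq_same[of z] by (simp add: prod.delta q_def)
      ultimately show ?thesis by (simp add: prod.distrib)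
    qed
    have "poly ((pderiv ^^ l) R) z = 0" if l: "l < M" for l
    proof -
      have "poly h z ^ l * poly ((pderiv ^^ l) R) z = poly (h ^ l * (pderiv ^^ l) R) z"
        by simp
      also have "h ^ l * (pderiv ^^ l) R = (\<Sum>j\<in>J. smult (x j) (h ^ l * (pderiv ^^ l) (T j)))"
        by (simp add: R_def higher_pderiv_sum higher_pderiv_smult sum_distrib_left)
      also have "poly \<dots> z = (\<Sum>j\<in>J. poly (smult (x j) (W l j)) z)"
        unfolding poly_sum
      proof (rule sum.cong[OF refl])
        fix j assume "j \<in> J"
        obtain e k i where j: "j = (e, k, i)" by (cases j)
        have "poly (h ^ l * (pderiv ^^ l) (T j)) z = poly (W l j) z"
          unfolding j derivs by (simp add: W_def G_z poly_monom)
        thus "poly (smult (x j) (h ^ l * (pderiv ^^ l) (T j))) z = poly (smult (x j) (W l j)) z"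
          by (simp only: poly_smult)
      qed
      also have "\<dots> = poly (\<Sum>j\<in>J. smult (x j) (W l j)) z"
        by (simp only: poly_sum)
      also have "\<dots> = 0" by (simp only: W_sum[OF l] poly_0)
      finally show ?thesis
        using zC by (auto simp: h_def poly_prod)
    qed
    hence "[:- z, 1:] ^ M dvd R"
      using M prime by (intro linear_power_dvd_if_higher_pderiv_zero) auto
    thus ?thesis using \<open>R \<noteq> 0\<close> by (simp add: order_divides)
  qed

  \<comment> \<open>Counting zeros with multiplicity\<close>
  have "M * card Z = (\<Sum>z\<in>Z. M)" by simp
  also have "\<dots> \<le> (\<Sum>z\<in>Z. count (proots R) z)"
    using order_R \<open>R \<noteq> 0\<close> by (intro sum_mono) simp
  also have "\<dots> = (\<Sum>z\<in>Z \<inter> set_mset (proots R). count (proots R) z)"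
    by (intro sum.mono_neutral_right) (auto simp: count_eq_zero_iff)
  also have "\<dots> \<le> size (proots R)"
    unfolding size_multiset_overloaded_eq by (intro sum_mono2) auto
  also have "\<dots> \<le> (K + m) * q"
    using size_proots_le[of R] degree_R by linarith
  finally show ?thesis
    by (simp add: Z_def D_def m_def)
qed

subsection \<open>Quartic character sums\<close>

text \<open>A translation moves the point \<open>c\<^sub>0\<close> with coprime exponent to
  \<open>0\<close>.\<close>

corollary stepanov_bound_translated:
  fixes C :: "'a::finite_field set" and a :: "'a \<Rightarrow> nat"
  defines "q \<equiv> CARD('a)"
  assumes prime: "CHAR('a) = q" and C: "c\<^sub>0 \<in> C" and d: "d dvd q - 1" and a: "coprime (a c\<^sub>0) d"
    and M: "0 < M" "M \<le> q"
    and less: "M * ((q - 1) div d + K + M * card C) < K * (q - 1)"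
  shows "M * card {z \<in> - C. (\<Prod>c\<in>C. (z - c) ^ (a c * ((q - 1) div d))) = \<epsilon>} \<le> (K + card C) * q"
proof -
  define C' where "C' = (\<lambda>c. c - c\<^sub>0) ` C"
  have inj: "inj_on (\<lambda>c. c - c\<^sub>0) A" for A by (auto simp: inj_on_def)
  have card: "card C' = card C" unfolding C'_def by (rule card_image[OF inj])
  have C': "0 \<in> C'" using C by (auto simp: C'_def)
  have "{z \<in> - C'. (\<Prod>c\<in>C'. (z - c) ^ (a (c + c\<^sub>0) * ((q - 1) div d))) = \<epsilon>} =
      (\<lambda>z. z - c\<^sub>0) ` {z \<in> - C. (\<Prod>c\<in>C. (z - c) ^ (a c * ((q - 1) div d))) = \<epsilon>}" (is "?A = _ ` ?B")
  proof (intro equalityI subsetI)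
    fix z assume "z \<in> ?A"
    hence "z + c\<^sub>0 \<in> ?B"
      by (auto simp: C'_def prod.reindex[OF inj] diff_diff_eq2 algebra_simps image_iff)
    thus "z \<in> (\<lambda>z. z - c\<^sub>0) ` ?B" by (intro image_eqI[of _ _ "z + c\<^sub>0"]) auto
  qed (auto simp: C'_def prod.reindex[OF inj])
  hence "card ?B = card ?A" by (simp add: card_image[OF inj])
  moreover have "M * card ?A \<le> (K + card C') * q"
    using assms C' unfolding q_def card by (intro stepanov_bound[of C', unfolded card]) simp_all
  ultimately show ?thesis by (simp add: card)
qed

lemma power_square_root_of_minus_one:
  fixes x :: "'b::comm_ring_1"
  assumes "x\<^sup>2 = - 1"
  shows "x ^ k = [1, x, - 1, - x] ! (k mod 4)"
proof -
  have x4: "x ^ 4 = 1"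
    using power_mult[of x 2 2] by (simp add: assms)
  have "x ^ k = x ^ (4 * (k div 4) + k mod 4)" by simp
  also have "\<dots> = x ^ (k mod 4)" unfolding power_add power_mult x4 by simp
  finally have *: "x ^ k = x ^ (k mod 4)" .
  have "k mod 4 = 0 \<or> k mod 4 = 1 \<or> k mod 4 = 2 \<or> k mod 4 = 3" by presburger
  moreover have "x ^ 3 = - x" using assms by (simp add: power3_eq_cube power2_eq_square)
  ultimately show ?thesis using assms * by auto
qed

text \<open>Upper bounds on the fibres suffice: as the powers of \<open>\<zeta>\<close> sum to
  \<open>0\<close>, each fibre size \<open>N\<close> may be replaced by \<open>B - N\<close>, which
  is nonnegative, and these numbers add up to \<open>d * B - card A\<close>.\<close>

lemma norm_sum_roots_of_unity_le:
  fixes \<zeta> :: complex and B :: real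
  assumes A: "finite A" and \<zeta>: "norm \<zeta> = 1" "(\<Sum>k<d. \<zeta> ^ k) = 0"
    and v: "\<And>z. z \<in> A \<Longrightarrow> v z < d" and B: "\<And>k. k < d \<Longrightarrow> card {z \<in> A. v z = k} \<le> B"
  shows "norm (\<Sum>z\<in>A. \<zeta> ^ v z) \<le> d * B - card A"
proof -
  let ?N = "\<lambda>k. card {z \<in> A. v z = k}"
  have fib: "(\<Sum>k<d. \<Sum>z | z \<in> A \<and> v z = k. h z) = (\<Sum>z\<in>A. h z)" for h :: "'a \<Rightarrow> 'b::comm_monoid_add"
    using A v by (intro sum.group) auto
  have "(\<Sum>z\<in>A. \<zeta> ^ v z) = (\<Sum>k<d. \<Sum>z | z \<in> A \<and> v z = k. \<zeta> ^ v z)"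
    by (simp only: fib)
  also have "\<dots> = (\<Sum>k<d. \<zeta> ^ k * ?N k)"
    by (simp add: mult.commute)
  also have "\<dots> = (\<Sum>k<d. B * \<zeta> ^ k - \<zeta> ^ k * of_real (B - ?N k))"
    by (simp add: algebra_simps)
  also have "\<dots> = - (\<Sum>k<d. \<zeta> ^ k * of_real (B - ?N k))"
    using \<zeta>(2) by (simp only: sum_subtractf sum_distrib_left[symmetric]) simp
  finally have "norm (\<Sum>z\<in>A. \<zeta> ^ v z) = norm (\<Sum>k<d. \<zeta> ^ k * of_real (B - ?N k))"
    by simp
  also have "\<dots> \<le> (\<Sum>k<d. norm (\<zeta> ^ k * of_real (B - ?N k)))"
    by (rule norm_sum)
  also have "\<dots> = (\<Sum>k<d. B - ?N k)"
    using B by (intro sum.cong refl) (simp add: norm_mult norm_power \<zeta>(1) norm_of_real del: of_real_diff)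
  also have "\<dots> = d * B - (\<Sum>k<d. \<Sum>z | z \<in> A \<and> v z = k. 1)"
    by (simp add: sum_subtractf)
  also have "\<dots> = d * B - card A"
    by (simp only: fib) simp
  finally show ?thesis .
qed

text \<open>Euler's criterion, with \<open>\<iota>\<close> identified with the complex
  \<open>\<i>\<close>. In the field considered below the last branch gives the value at
  \<open>u = 0\<close>.\<close>

definition quartic_char :: "'a::{finite, comm_ring_1} \<Rightarrow> 'a \<Rightarrow> complex" where
  "quartic_char \<iota> u = (let w = u ^ ((CARD('a) - 1) div 4) in
     if w = 1 then 1 else if w = \<iota> then \<i> else if w = - 1 then - 1 else if w = - \<iota> then - \<i> else 0)"

text \<open>\<open>CHAR('a) = q\<close> makes the field prime, as Stepanov's bound requires.
  \<open>16 dvd q - 1\<close> makes \<open>(q - 1) div 4\<close> a multiple of \<open>4\<close>, so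
  that the character is \<open>1\<close> at \<open>\<iota>\<close> and at
  \<open>- 1\<close>.\<close>

locale quartic_field =
  fixes \<iota> :: "'a::finite_field" and q :: nat
  assumes q_def: "q = CARD('a)" and prime: "CHAR('a) = q" and q16: "16 dvd q - 1" and \<iota>: "\<iota>\<^sup>2 = - 1"
begin

abbreviation \<chi> :: "'a \<Rightarrow> complex" where "\<chi> \<equiv> quartic_char \<iota>"

definition n :: nat where "n = (q - 1) div 4"

lemma q1: "1 < q"
  using prime CHAR_prime[where ?'a = 'a] prime_gt_1_nat by metis

lemma n4: "q - 1 = n * 4" "4 dvd n"
proof -
  obtain k where "q - 1 = 16 * k" using q16 ..
  thus "q - 1 = n * 4" "4 dvd n" by (auto simp: n_def)
qed

lemma n0: "0 < n"
  using n4 q1 by (cases n) auto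

lemma real_card_Compl: "real (card (- C)) = real q - card (C :: 'a set)"
  using card_mono[of UNIV C] by (simp add: Compl_eq_Diff_UNIV card_Diff_subset q_def of_nat_diff)

lemma two_neq_0: "(2 :: 'a) \<noteq> 0"
proof
  assume "(2 :: 'a) = 0"
  hence "CHAR('a) dvd 2" using of_nat_eq_0_iff_char_dvd[of 2, where ?'a = 'a] by simp
  hence "q \<le> 2" using prime by (auto dest: dvd_imp_le)
  moreover have "16 \<le> q - 1" using q16 q1 by (intro dvd_imp_le) auto
  ultimately show False by simp
qed

lemma one_neq_minus_one: "(1 :: 'a) \<noteq> - 1"
  using two_neq_0 by (metis add.right_inverse one_add_one)

lemma \<iota>_neq: "\<iota> \<noteq> 1" "\<iota> \<noteq> - 1" "\<iota> \<noteq> 0" "\<iota> \<noteq> - \<iota>" "\<iota> * \<iota> = - 1"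
proof -
  show "\<iota> * \<iota> = - 1" using \<iota> by (simp add: power2_eq_square)
  thus "\<iota> \<noteq> 1" "\<iota> \<noteq> - 1" "\<iota> \<noteq> 0" using one_neq_minus_one by auto
  thus "\<iota> \<noteq> - \<iota>" using two_neq_0 by (metis add.right_inverse mult_2 mult_eq_0_iff)
qed

lemma fermat: "u \<noteq> 0 \<Longrightarrow> u ^ (q - 1) = (1 :: 'a)"
  unfolding q_def by (rule finite_field_power_card_minus_one)

lemma power_n:
  assumes "u \<noteq> 0"
  obtains k where "u ^ n = \<iota> ^ k" "k < 4"
proof -
  define w where "w = u ^ n"
  have "w ^ 4 = u ^ (q - 1)"
    unfolding w_def n4(1) by (simp only: power_mult)
  hence "w ^ 4 = 1" using fermat[OF assms] by simp
  moreover have "(w - 1) * (w + 1) * ((w - \<iota>) * (w + \<iota>)) = w ^ 4 - 1 + (\<iota>\<^sup>2 + 1) * (1 - w\<^sup>2)"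
    by (simp add: algebra_simps power2_eq_square power4_eq_xxxx)
  ultimately have "(w - 1) * (w + 1) * ((w - \<iota>) * (w + \<iota>)) = 0"
    using \<iota> by simp
  hence "w = 1 \<or> w = - 1 \<or> w = \<iota> \<or> w = - \<iota>"
    by (auto simp: eq_neg_iff_add_eq_0)
  moreover have "\<iota> ^ 3 = - \<iota>" using \<iota> by (simp add: power3_eq_cube power2_eq_square)
  ultimately show ?thesis
    using that[of 0] that[of 1] that[of 2] that[of 3] \<iota> unfolding w_def by auto
qed

lemma \<chi>_eq:
  assumes "u ^ n = \<iota> ^ k"
  shows "\<chi> u = \<i> ^ k"
proof -
  define w where "w = u ^ n"
  have "k mod 4 = 0 \<or> k mod 4 = 1 \<or> k mod 4 = 2 \<or> k mod 4 = 3" by presburger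
  hence "w = 1 \<and> \<i> ^ k = 1 \<or> w = \<iota> \<and> \<i> ^ k = \<i> \<or> w = - 1 \<and> \<i> ^ k = - 1 \<or> w = - \<iota> \<and> \<i> ^ k = - \<i>"
    using power_square_root_of_minus_one[OF \<iota>, of k] power_square_root_of_minus_one[of \<i> k]
    unfolding w_def assms by auto
  moreover have "\<iota> \<noteq> 1" "- 1 \<noteq> (1 :: 'a)" "- 1 \<noteq> \<iota>" "- \<iota> \<noteq> 1" "- \<iota> \<noteq> \<iota>" "- \<iota> \<noteq> - 1"
    using \<iota>_neq one_neq_minus_one by (metis minus_minus)+
  ultimately show ?thesis
    unfolding quartic_char_def q_def[symmetric] n_def[symmetric] w_def[symmetric] Let_def
    by (elim disjE conjE) (simp_all only: if_True if_False simp_thms)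
qed

lemma \<chi>_mult:
  assumes "u \<noteq> 0" "v \<noteq> 0"
  shows "\<chi> (u * v) = \<chi> u * \<chi> v"
proof -
  obtain k l where kl: "u ^ n = \<iota> ^ k" "v ^ n = \<iota> ^ l" using power_n assms by metis
  have "\<chi> (u * v) = \<i> ^ (k + l)"
    by (rule \<chi>_eq) (simp add: kl power_mult_distrib power_add)
  thus ?thesis using kl[THEN \<chi>_eq] by (simp add: power_add)
qed

lemma \<chi>_0: "\<chi> 0 = 0"
  using n0 \<iota>_neq unfolding quartic_char_def q_def[symmetric] n_def[symmetric]
  by (simp add: Let_def power_0_left)

lemma \<chi>_cases: "u \<noteq> 0 \<Longrightarrow> \<chi> u \<in> {1, \<i>, - 1, - \<i>}"
proof -
  assume "u \<noteq> 0"
  then obtain k where k: "u ^ n = \<iota> ^ k" "k < 4" by (rule power_n)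
  hence "k = 0 \<or> k = 1 \<or> k = 2 \<or> k = 3" by linarith
  thus ?thesis using \<chi>_eq[OF k(1)] by (auto simp: power3_eq_cube)
qed

lemma \<chi>_power4: "u \<noteq> 0 \<Longrightarrow> \<chi> u ^ 4 = 1"
  using \<chi>_cases[of u] by (auto simp: power4_eq_xxxx)

lemma \<chi>_1: "\<chi> 1 = 1"
  using \<chi>_eq[of 1 0] by simp

lemma \<chi>_\<iota>: "\<chi> \<iota> = 1"
proof -
  obtain k where "n = 4 * k" using n4(2) ..
  hence "\<iota> ^ n = 1" using power_square_root_of_minus_one[OF \<iota>, of n] by simp
  thus ?thesis using \<chi>_eq[of \<iota> 0] by simp
qed

lemma \<chi>_minus: "\<chi> (- u) = \<chi> u"
proof -
  have "even n" using n4(2) by (metis dvd_trans even_numeral)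
  thus ?thesis
    unfolding quartic_char_def q_def[symmetric] n_def[symmetric] by simp
qed

lemma \<chi>_\<iota>_mult: "\<chi> (\<iota> * u) = \<chi> u"
  using \<chi>_mult[of \<iota> u] \<chi>_\<iota> \<iota>_neq by (cases "u = 0") simp_all

lemma \<chi>_power: "u \<noteq> 0 \<Longrightarrow> \<chi> (u ^ k) = \<chi> u ^ k"
  by (induction k) (simp_all add: \<chi>_1 \<chi>_mult)

lemma \<chi>_prod: "(\<And>c. c \<in> C \<Longrightarrow> f c \<noteq> 0) \<Longrightarrow> \<chi> (\<Prod>c\<in>C. f c) = (\<Prod>c\<in>C. \<chi> (f c))"
  by (induction C rule: infinite_finite_induct) (simp_all add: \<chi>_1 \<chi>_mult)

text \<open>Stepanov's bound limits every fibre of the character product to little more than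
  \<open>q / d\<close> points, which bounds the sum. The condition on \<open>M\<close> allows it to
  be of the order of the square root of \<open>q\<close>, so the result is of that order as
  well.\<close>

lemma char_sum_bound:
  fixes C :: "'a set" and a :: "'a \<Rightarrow> nat"
  assumes C: "c\<^sub>0 \<in> C" "\<not> 4 dvd a c\<^sub>0"
    and M: "0 < M" "M \<le> q" "4 dvd M" "M * (M + card C + M * card C) < card C * (q - 1)"
  shows "norm (\<Sum>z\<in>- C. \<Prod>c\<in>C. \<chi> (z - c) ^ a c) \<le> 8 * card C * q / M + card C"
proof -
  define m where "m = card C"
  obtain r d b c\<^sub>1 where rd: "r * d = 4" "d \<le> 4" "norm (\<i> ^ r) = 1" "(\<Sum>k<d. (\<i> ^ r) ^ k) = 0"
    and b: "\<And>c. c \<in> C \<Longrightarrow> a c = r * b c" and c\<^sub>1: "c\<^sub>1 \<in> C" "coprime (b c\<^sub>1) d"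
  proof (cases "\<exists>c\<in>C. odd (a c)")
    case True
    then obtain c where c: "c \<in> C" "odd (a c)" by blast
    have "coprime (a c) (2 ^ 2)"
      using c(2) by (simp only: coprime_power_right_iff coprime_right_2_iff_odd simp_thms)
    moreover have "(\<Sum>k<4. (\<i> ^ 1) ^ k) = 0"
      by (simp add: eval_nat_numeral)
    ultimately show ?thesis
      using c(1) by (intro that[of 1 4 a c]) simp_all
  next
    case False
    hence even: "\<And>c. c \<in> C \<Longrightarrow> even (a c)" by blast
    have "odd (a c\<^sub>0 div 2)" using even[OF C(1)] C(2) by presburger
    moreover have "(\<Sum>k<2. (\<i> ^ 2) ^ k) = 0"
      by (simp add: eval_nat_numeral)
    ultimately show ?thesis
      using C(1) even by (intro that[of 2 2 "\<lambda>c. a c div 2" c\<^sub>0]) simp_all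
  qed
  have d0: "0 < d" using rd(1) by (cases d) auto
  have dvd: "d dvd q - 1" "d dvd M"
    using rd(1) n4 M(3) by (metis dvd_trans dvd_triv_right)+
  then obtain t where t: "M = d * t" by blast
  have nr: "(q - 1) div d = n * r"
    using n4(1) d0 unfolding rd(1)[symmetric] by simp
  \<comment> \<open>With \<open>K = t + m\<close> the main terms \<open>M * ((q - 1) div d)\<close>
    and \<open>t * (q - 1)\<close> cancel, and the surplus \<open>m * (q - 1)\<close> pays for the
    rest.\<close>
  have bound: "M * card {z \<in> - C. (\<Prod>c\<in>C. (z - c) ^ (b c * ((q - 1) div d))) = \<epsilon>} \<le> (t + m + m) * q" for \<epsilon>
  proof -
    have "M * (t + m + M * m) \<le> M * (M + card C + M * card C)"
      using d0 by (intro mult_left_mono add_mono) (auto simp: t m_def)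
    hence "M * (t + m + M * m) < m * (q - 1)" using M(4) unfolding m_def[symmetric] by (rule le_less_trans)
    moreover have "M * ((q - 1) div d) = t * (q - 1)"
      using dvd(1) d0 by (simp add: t div_mult_swap)
    ultimately have "M * ((q - 1) div d + (t + m) + M * m) < (t + m) * (q - 1)"
      unfolding distrib_left distrib_right by linarith
    thus ?thesis
      using stepanov_bound_translated[of c\<^sub>1 C d b M "t + m" \<epsilon>] prime c\<^sub>1 dvd(1) M(1,2)
      unfolding q_def[symmetric] m_def by simp
  qed
  define w where "w = (\<lambda>z. \<Prod>c\<in>C. (z - c) ^ b c)"
  define v where "v = (\<lambda>z. (SOME k. w z ^ n = \<iota> ^ k) mod d)"
  define \<omega> where "\<omega> = \<iota> ^ r"
  have w0: "w z \<noteq> 0" if "z \<in> - C" for z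
    using that by (auto simp: w_def)
  have "\<omega> ^ d = 1" "(\<i> ^ r) ^ d = 1"
    using power_square_root_of_minus_one[OF \<iota>, of 4] power_square_root_of_minus_one[of \<i> 4]
    by (simp_all add: \<omega>_def rd(1) flip: power_mult)
  hence mod: "\<omega> ^ (k mod d) = \<omega> ^ k" "(\<i> ^ r) ^ (k mod d) = (\<i> ^ r) ^ k" for k
    by (metis div_mult_mod_eq mult.commute mult_1 power_add power_mult power_one)+
  have v: "w z ^ (n * r) = \<omega> ^ v z" "\<chi> (w z) ^ r = (\<i> ^ r) ^ v z" if "z \<in> - C" for z
  proof -
    define k where "k = (SOME k. w z ^ n = \<iota> ^ k)"
    have "\<exists>k. w z ^ n = \<iota> ^ k" using power_n[OF w0[OF that]] by metis
    hence k: "w z ^ n = \<iota> ^ k" unfolding k_def by (rule someI_ex)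
    have "\<omega> ^ v z = \<omega> ^ k" "(\<i> ^ r) ^ v z = (\<i> ^ r) ^ k" unfolding v_def k_def mod by simp_all
    thus "w z ^ (n * r) = \<omega> ^ v z" "\<chi> (w z) ^ r = (\<i> ^ r) ^ v z"
      using k \<chi>_eq[OF k] by (simp_all add: \<omega>_def power_mult) (metis power_mult mult.commute)+
  qed
  have "(\<Prod>c\<in>C. \<chi> (z - c) ^ a c) = (\<i> ^ r) ^ v z" if "z \<in> - C" for z
  proof -
    have "\<chi> (w z) = (\<Prod>c\<in>C. \<chi> ((z - c) ^ b c))"
      unfolding w_def using that by (intro \<chi>_prod) auto
    also have "\<dots> = (\<Prod>c\<in>C. \<chi> (z - c) ^ b c)"
      using that by (intro prod.cong refl \<chi>_power) auto
    finally have "\<chi> (w z) ^ r = (\<Prod>c\<in>C. \<chi> (z - c) ^ b c) ^ r" by simp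
    also have "\<dots> = (\<Prod>c\<in>C. \<chi> (z - c) ^ a c)"
      unfolding prod_power_distrib by (intro prod.cong refl) (simp add: b mult.commute flip: power_mult)
    finally show ?thesis using v(2)[OF that] by simp
  qed
  hence "norm (\<Sum>z\<in>- C. \<Prod>c\<in>C. \<chi> (z - c) ^ a c) = norm (\<Sum>z\<in>- C. (\<i> ^ r) ^ v z)"
    by (intro arg_cong[where f = norm] sum.cong refl)
  also have "\<dots> \<le> d * ((t + m + m) * q / M) - card (- C)"
  proof (rule norm_sum_roots_of_unity_le[OF _ rd(3,4)])
    fix k
    have "{z \<in> - C. v z = k} \<subseteq> {z \<in> - C. (\<Prod>c\<in>C. (z - c) ^ (b c * ((q - 1) div d))) = \<omega> ^ k}"
    proof safe
      fix z assume z: "z \<notin> C" "k = v z"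
      have "(\<Prod>c\<in>C. (z - c) ^ (b c * (n * r))) = w z ^ (n * r)"
        unfolding w_def prod_power_distrib by (simp add: power_mult)
      thus "(\<Prod>c\<in>C. (z - c) ^ (b c * ((q - 1) div d))) = \<omega> ^ v z"
        unfolding nr using z v(1)[of z] by simp
    qed
    hence "M * card {z \<in> - C. v z = k} \<le> (t + m + m) * q"
      using bound[of "\<omega> ^ k"] by (meson card_mono finite le_trans mult_le_mono2)
    hence "real M * card {z \<in> - C. v z = k} \<le> (t + m + m) * q"
      by (metis of_nat_le_iff of_nat_mult)
    thus "card {z \<in> - C. v z = k} \<le> (t + m + m) * q / M"
      using M(1) by (simp add: field_simps)
  qed (use d0 in \<open>auto simp: v_def\<close>)
  also have "\<dots> = 2 * d * m * q / M + m"
  proof -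
    have "real (card (- C)) = q - real m"
      by (simp add: real_card_Compl m_def)
    moreover have "d * ((t + m + m) * q / M) = q + 2 * d * m * q / M"
      using M(1) by (simp add: t field_simps)
    ultimately show ?thesis by simp
  qed
  also have "\<dots> \<le> 8 * m * q / M + m"
    using rd(2) by (intro add_right_mono divide_right_mono) (auto intro!: mult_right_mono)
  finally show ?thesis by (simp add: m_def)
qed


text \<open>Roots of unity filter: the joint condition is detected by the product over the conditions of the
  sums of all powers, and expanding it leaves the trivial character plus nontrivial character sums.\<close>

lemma exists_prescribed_characters:
  fixes c :: "nat \<Rightarrow> 'a" and a :: "nat \<Rightarrow> nat \<Rightarrow> nat" and d :: "nat \<Rightarrow> nat" and t :: "nat \<Rightarrow> complex"
  assumes c: "inj_on c {..<m}"
    and d: "\<And>l. l < k \<Longrightarrow> 0 < d l" "\<And>l j. l < k \<Longrightarrow> j < m \<Longrightarrow> 4 dvd d l * a l j"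
    and t: "\<And>l. l < k \<Longrightarrow> norm (t l) = 1 \<and> t l ^ d l = 1"
    and indep: "\<And>e. (\<And>l. l < k \<Longrightarrow> e l < d l) \<Longrightarrow> (\<And>j. j < m \<Longrightarrow> 4 dvd (\<Sum>l<k. e l * a l j)) \<Longrightarrow> \<forall>l<k. e l = 0"
    and M: "0 < M" "M \<le> q" "4 dvd M" "M * (M + m + M * m) < m * (q - 1)"
    and large: "(\<Prod>l<k. d l) * (8 * m * q / M + m) < real q - m"
  shows "\<exists>z. z \<notin> c ` {..<m} \<and> (\<forall>l<k. (\<Prod>j<m. \<chi> (z - c j) ^ a l j) = t l)"
proof (rule ccontr)
  assume none: "\<not> ?thesis"
  define C where "C = c ` {..<m}"
  have card_C: "card C = m" using c by (simp add: C_def card_image)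
  define g where "g = (\<lambda>l z. cnj (t l) * (\<Prod>j<m. \<chi> (z - c j) ^ a l j))"
  define E where "E = (\<Pi>\<^sub>E l\<in>{..<k}. {..<d l})"
  define e\<^sub>0 where "e\<^sub>0 = (\<lambda>l\<in>{..<k}. 0 :: nat)"
  define B where "B = 8 * m * q / M + m"
  have nz: "z - c j \<noteq> 0" if "z \<in> - C" "j < m" for z j
    using that by (auto simp: C_def)
  have cnj_t: "cnj (t l) * t l = 1" if "l < k" for l
    using t[OF that] complex_norm_square[of "t l"] by (simp add: mult.commute)
  have g1: "g l z ^ d l = 1" if z: "z \<in> - C" and l: "l < k" for z l
  proof -
    have "\<chi> (z - c j) ^ (a l j * d l) = 1" if "j < m" for j
    proof -
      obtain s where "a l j * d l = 4 * s" using d(2)[OF l \<open>j < m\<close>] by (auto simp: mult.commute)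
      thus ?thesis using \<chi>_power4[OF nz[OF z \<open>j < m\<close>]] by (simp add: power_mult)
    qed
    moreover have "cnj (t l) ^ d l = 1"
      using t[OF l] by (metis complex_cnj_one complex_cnj_power)
    ultimately show ?thesis
      by (simp add: g_def power_mult_distrib prod_power_distrib flip: power_mult)
  qed
  \<comment> \<open>The conditions at \<open>z\<close> say that all \<open>g l z\<close> are
    \<open>1\<close>. If one fails, that \<open>g l z\<close> is a nontrivial \<open>d l\<close>-th
    root of unity, whose powers sum to \<open>0\<close>.\<close>
  have zero: "(\<Prod>l<k. \<Sum>e<d l. g l z ^ e) = 0" if z: "z \<in> - C" for z
  proof -
    obtain l where l: "l < k" "(\<Prod>j<m. \<chi> (z - c j) ^ a l j) \<noteq> t l"
      using none z by (auto simp: C_def)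
    have "g l z \<noteq> 1"
    proof
      assume "g l z = 1"
      hence "t l * (cnj (t l) * (\<Prod>j<m. \<chi> (z - c j) ^ a l j)) = t l" by (simp add: g_def)
      thus False using l cnj_t[OF l(1)] by (simp add: mult.assoc[symmetric] mult.commute[of "t l"])
    qed
    hence "(\<Sum>e<d l. g l z ^ e) = 0"
      using g1[OF z l(1)] by (simp add: geometric_sum)
    thus ?thesis using l(1) by (intro prod_zero) auto
  qed
  define s where "s = (\<lambda>e. \<Sum>z\<in>- C. \<Prod>l<k. g l z ^ e l)"
  have "0 = (\<Sum>z\<in>- C. \<Prod>l<k. \<Sum>e<d l. g l z ^ e)" by (simp add: zero)
  also have "\<dots> = (\<Sum>z\<in>- C. \<Sum>e\<in>E. \<Prod>l<k. g l z ^ e l)"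
    unfolding E_def by (subst prod_sum_PiE) auto
  also have "\<dots> = (\<Sum>e\<in>E. s e)"
    unfolding s_def by (rule sum.swap)
  finally have sum0: "(\<Sum>e\<in>E. s e) = 0" by simp
  have fin: "finite E" unfolding E_def by (intro finite_PiE) auto
  have e0: "e\<^sub>0 \<in> E" using d(1) by (auto simp: e\<^sub>0_def E_def)
  have "s e\<^sub>0 = of_real (real (card (- C)))" by (simp add: s_def e\<^sub>0_def)
  also have "real (card (- C)) = real q - m"
    by (simp add: real_card_Compl card_C)
  finally have s_e0: "s e\<^sub>0 = of_real (real q - m)" .
  have bound: "norm (s e) \<le> B" if e: "e \<in> E - {e\<^sub>0}" for e
  proof -
    have e_less: "e l < d l" if "l < k" for l using e that by (auto simp: E_def PiE_iff)
    define b where "b = (\<lambda>j. \<Sum>l<k. e l * a l j)"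
    \<comment> \<open>By \<open>indep\<close>, only the zero exponent vector gives the trivial
      character.\<close>
    have "\<exists>j<m. \<not> 4 dvd b j"
    proof (rule ccontr)
      assume not: "\<not> ?thesis"
      have dvd: "4 dvd (\<Sum>l<k. e l * a l j)" if "j < m" for j
        using not that unfolding b_def by blast
      have zero: "\<forall>l<k. e l = 0" by (rule indep[OF e_less dvd])
      have "e \<in> E" using e by simp
      from PiE_ext[OF this[unfolded E_def] e0[unfolded E_def]] have "e = e\<^sub>0"
        using zero by (simp add: e\<^sub>0_def)
      thus False using e by simp
    qed
    then obtain j\<^sub>0 where j\<^sub>0: "j\<^sub>0 < m" "\<not> 4 dvd b j\<^sub>0" by blast
    define b' where "b' = b \<circ> the_inv_into {..<m} c"
    have b': "b' (c j) = b j" if "j < m" for j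
      using that c by (simp add: b'_def the_inv_into_f_f)
    define u where "u = (\<Prod>l<k. cnj (t l) ^ e l)"
    have "norm u = 1" using t by (simp add: u_def prod_norm[symmetric] norm_power)
    have "(\<Prod>l<k. g l z ^ e l) = u * (\<Prod>x\<in>C. \<chi> (z - x) ^ b' x)" for z
    proof -
      have "(\<Prod>l<k. g l z ^ e l) = u * (\<Prod>l<k. \<Prod>j<m. \<chi> (z - c j) ^ (e l * a l j))"
        unfolding g_def u_def power_mult_distrib prod.distrib prod_power_distrib
        by (simp add: mult.commute flip: power_mult)
      also have "(\<Prod>l<k. \<Prod>j<m. \<chi> (z - c j) ^ (e l * a l j)) = (\<Prod>j<m. \<Prod>l<k. \<chi> (z - c j) ^ (e l * a l j))"
        by (rule prod.swap)
      also have "\<dots> = (\<Prod>j<m. \<chi> (z - c j) ^ b' (c j))"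
        by (intro prod.cong refl) (simp add: b' b_def power_sum)
      also have "\<dots> = (\<Prod>x\<in>C. \<chi> (z - x) ^ b' x)"
        unfolding C_def by (simp add: prod.reindex[OF c])
      finally show ?thesis .
    qed
    hence "s e = u * (\<Sum>z\<in>- C. \<Prod>x\<in>C. \<chi> (z - x) ^ b' x)"
      by (simp add: s_def sum_distrib_left)
    hence "norm (s e) = norm (\<Sum>z\<in>- C. \<Prod>x\<in>C. \<chi> (z - x) ^ b' x)"
      using \<open>norm u = 1\<close> by (simp add: norm_mult)
    also have "\<dots> \<le> B"
    proof -
      have "c j\<^sub>0 \<in> C" "\<not> 4 dvd b' (c j\<^sub>0)" using j\<^sub>0 b' by (simp_all add: C_def)
      from char_sum_bound[of "c j\<^sub>0" C b', OF this M(1,2,3)] show ?thesis using M(4) by (simp add: card_C B_def)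
    qed
    finally show ?thesis .
  qed
  have "real q - m \<le> norm (s e\<^sub>0)" unfolding s_e0 norm_of_real by simp
  also have "s e\<^sub>0 = - (\<Sum>e\<in>E - {e\<^sub>0}. s e)"
    using sum0 by (simp add: sum.remove[OF fin e0] eq_neg_iff_add_eq_0)
  also have "norm \<dots> \<le> (\<Sum>e\<in>E - {e\<^sub>0}. B)"
    unfolding norm_minus_cancel by (rule order_trans[OF norm_sum]) (rule sum_mono[OF bound])
  also have "\<dots> \<le> card E * B"
    using fin by (auto simp: B_def intro!: mult_right_mono card_mono)
  also have "card E = (\<Prod>l<k. d l)"
    unfolding E_def by (simp add: card_PiE)
  finally show False using large by (simp add: B_def)
qed

text \<open>The identity matrix of exponents prescribes every character separately, at the cost
  \<open>4 ^ length cs\<close>.\<close>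

corollary exists_prescribed_classes:
  fixes cs :: "'a list"
  assumes cs: "distinct cs" "length ts = length cs" and t: "set ts \<subseteq> {1, \<i>, - 1, - \<i>}"
    and M: "0 < M" "M \<le> q" "4 dvd M" "M * (M + length cs + M * length cs) < length cs * (q - 1)"
    and large: "4 ^ length cs * (8 * length cs * q / M + length cs) < real q - length cs"
  shows "\<exists>z. map (\<lambda>c. \<chi> (z - c)) cs = ts"
proof -
  let ?m = "length cs"
  have "\<exists>z. z \<notin> (!) cs ` {..<?m} \<and>
      (\<forall>l<?m. (\<Prod>j<?m. \<chi> (z - cs ! j) ^ (if j = l then 1 else 0)) = ts ! l)"
  proof (rule exists_prescribed_characters[where d = "\<lambda>_. 4" and M = M])
    show "inj_on ((!) cs) {..<?m}" using cs(1) by (simp add: inj_on_nth)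
    show "norm (ts ! l) = 1 \<and> ts ! l ^ 4 = 1" if "l < ?m" for l
    proof -
      have "ts ! l \<in> {1, \<i>, - 1, - \<i>}" using t that cs(2) by (metis nth_mem subsetD)
      thus ?thesis by (auto simp: power4_eq_xxxx)
    qed
    show "\<forall>l<?m. e l = 0" if "\<And>l. l < ?m \<Longrightarrow> e l < 4" "\<And>j. j < ?m \<Longrightarrow> 4 dvd (\<Sum>l<?m. e l * (if j = l then 1 else 0))"
      for e :: "nat \<Rightarrow> nat"
    proof (intro allI impI)
      fix l assume l: "l < ?m"
      have "4 dvd e l" using that(2)[OF l] l by (simp add: if_distrib[of "(*) _"] sum.delta cong: if_cong)
      thus "e l = 0" using that(1)[OF l] by (auto elim!: dvdE)
    qed
  qed (use M large in simp_all)
  then obtain z where z: "\<And>l. l < ?m \<Longrightarrow> (\<Prod>j<?m. \<chi> (z - cs ! j) ^ (if j = l then 1 else 0)) = ts ! l"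
    by blast
  have "\<chi> (z - cs ! l) = ts ! l" if "l < ?m" for l
    using z[OF that] that by (simp add: if_distrib[of "(^) _"] prod.delta cong: if_cong)
  thus ?thesis using cs(2) by (intro exI[of _ z] nth_equalityI) auto
qed

end

subsection \<open>Large primes\<close>

abbreviation fourth_roots :: "complex set" where
  "fourth_roots \<equiv> {1, \<i>, - 1, - \<i>}"

text \<open>Used when two entries of a row of \<open>quads\<close> are already determined: the other
  two are then given the remaining classes.\<close>

lemma complementary_fourth_roots:
  assumes "u \<in> fourth_roots" "v \<in> fourth_roots" "u \<noteq> v"
  shows "\<exists>s t. s \<in> fourth_roots \<and> t \<in> fourth_roots \<and> distinct [u, v, s, t]"
proof -
  have "card fourth_roots = 4" by (simp add: complex_eq_iff)
  hence "card (fourth_roots - {u, v}) = 2"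
    using assms by (subst card_Diff_subset) (simp_all only: insert_subset empty_subsetI card_2_iff finite.intros, auto)
  then obtain s t where st: "fourth_roots - {u, v} = {s, t}" "s \<noteq> t"
    unfolding card_2_iff by blast
  have "s \<in> fourth_roots - {u, v}" "t \<in> fourth_roots - {u, v}" unfolding st(1) by simp_all
  thus ?thesis using assms(3) st(2) by (intro exI[of _ s] exI[of _ t]) auto
qed

text \<open>Rows of this shape require only ratios and squares of characters, which are cheaper to
  prescribe than the characters.\<close>

lemma distinct_opposite_pairs:
  fixes u v :: complex
  assumes "u \<noteq> 0" "v \<noteq> 0" "u\<^sup>2 \<noteq> v\<^sup>2"
  shows "distinct [u, - u, v, - v]"
  using assms by (auto simp: eq_neg_iff_add_eq_0 power2_eq_iff)

context quartic_field
begin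

definition orbit :: "'a \<Rightarrow> 'a list" where
  "orbit w = [w, - w, \<iota> * w, - (\<iota> * w)]"

lemma length_orbit: "length (orbit w) = 4"
  by (simp add: orbit_def)

lemma distinct_orbit: "w \<noteq> 0 \<Longrightarrow> distinct (orbit w)"
proof -
  assume w: "w \<noteq> 0"
  have neg: "v \<noteq> - v" if "v \<noteq> 0" for v :: 'a
    using that two_neq_0 by (metis add.right_inverse mult_2 mult_eq_0_iff)
  have "\<iota> * w \<noteq> w" "\<iota> * w \<noteq> - w"
    using w \<iota>_neq mult_cancel_right[of \<iota> w 1] mult_cancel_right[of \<iota> w "- 1"] by simp_all
  moreover from this have "w \<noteq> - (\<iota> * w)" by (metis minus_minus)
  ultimately have "w \<noteq> \<iota> * w" "- w \<noteq> \<iota> * w" "w \<noteq> - (\<iota> * w)" by simp_all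
  moreover have "w \<noteq> - w" "\<iota> * w \<noteq> - (\<iota> * w)"
    using neg w \<iota>_neq(3) by simp_all
  ultimately show ?thesis by (simp add: orbit_def)
qed

lemma zero_notin_orbit: "w \<noteq> 0 \<Longrightarrow> 0 \<notin> set (orbit w)"
  using \<iota>_neq by (simp add: orbit_def)

lemma orbit_power4: "v \<in> set (orbit w) \<Longrightarrow> v ^ 4 = w ^ 4"
  using power_square_root_of_minus_one[OF \<iota>, of 4] by (auto simp: orbit_def power_mult_distrib)

lemma orbit_disjoint: "v ^ 4 \<noteq> w ^ 4 \<Longrightarrow> set (orbit v) \<inter> set (orbit w) = {}"
  by (metis orbit_power4 disjoint_iff)

text \<open>The roots of \<open>X ^ 4 - w ^ 4\<close> are the elements of the orbit, so avoiding
  them makes the new orbit disjoint from the old one.\<close>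

lemma power4_neq:
  assumes "\<And>c. c \<in> set (orbit w) \<Longrightarrow> z \<noteq> c"
  shows "z ^ 4 \<noteq> w ^ 4"
proof
  assume "z ^ 4 = w ^ 4"
  moreover have "(z - w) * (z + w) * ((z - \<iota> * w) * (z + \<iota> * w)) = z ^ 4 - w ^ 4 + (\<iota>\<^sup>2 + 1) * (w ^ 4 - z\<^sup>2 * w\<^sup>2)"
    by (simp add: algebra_simps power2_eq_square power4_eq_xxxx)
  ultimately have "(z - w) * (z + w) * ((z - \<iota> * w) * (z + \<iota> * w)) = 0" using \<iota> by simp
  thus False using assms by (auto simp: orbit_def eq_neg_iff_add_eq_0)
qed

lemma \<chi>_neq_0: "\<chi> u \<in> fourth_roots \<Longrightarrow> u \<noteq> 0"
  using \<chi>_0 by auto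

text \<open>Rows \<open>0\<close>, \<open>1\<close>, \<open>2\<close>, \<open>4\<close>,
  \<open>8\<close> receive four different classes outright (row \<open>0\<close> up to the factor
  \<open>\<chi> 2\<close>); rows \<open>3\<close>, \<open>5\<close>, \<open>6\<close>,
  \<open>7\<close> become two pairs of opposite values.\<close>

theorem exists_quads:
  assumes large: "344806 * 10 ^ 12 \<le> q"
  shows "\<exists>x y z. \<forall>vs \<in> set (quads \<iota> x y z). distinct (map \<chi> vs) \<and> 0 \<notin> \<chi> ` set vs"
proof -
  define \<kappa> where "\<kappa> = \<chi> (1 + \<iota>)"
  have \<iota>1: "1 + \<iota> \<noteq> 0" using \<iota>_neq(2) by (metis add.commute eq_neg_iff_add_eq_0)
  have \<kappa>: "\<kappa> \<in> fourth_roots" unfolding \<kappa>_def by (rule \<chi>_cases[OF \<iota>1])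
  \<comment> \<open>\<open>num\<close> restricts \<open>M\<close> to the order of the square root of
    \<open>q\<close>, most tightly for five points; with this value
    \<open>2 ^ 21 * 8 * 13 / M\<close> is still below \<open>1/2\<close>, as the choice of
    \<open>z\<close> demands.\<close>
  define M :: nat where "M = 5 * 10 ^ 8"
  have M: "0 < M" "M \<le> q" "4 dvd M" using large by (simp_all add: M_def)
  have q: "344805 * 10 ^ 12 \<le> q - 1" using large by simp
  have num: "M * (M + 5 + M * 5) < 5 * (q - 1)" "M * (M + 9 + M * 9) < 9 * (q - 1)"
    "M * (M + 13 + M * 13) < 13 * (q - 1)"
    by (rule less_le_trans[OF _ mult_left_mono[OF q]]; simp add: M_def)+

  \<comment> \<open>\<open>\<kappa>\<close> is given, and the last four conditions keep the first
    two entries of rows \<open>2\<close>, \<open>4\<close>, \<open>8\<close>, \<open>1\<close>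
    apart. The choice \<open>\<i>\<close>, \<open>- 1\<close>, \<open>- \<i>\<close> violates them
    only if \<open>\<kappa> = \<i>\<close>.\<close>
  obtain b2 b4 b8 where b: "b2 \<in> fourth_roots" "b4 \<in> fourth_roots" "b8 \<in> fourth_roots"
    "distinct [1, b2, b4, b8]" "b2 \<noteq> \<kappa>" "b4 \<noteq> b2 * \<kappa>" "b8 \<noteq> b4 * \<kappa>" "1 \<noteq> b8 * \<kappa>"
  proof (cases "\<kappa> = \<i>")
    case True
    thus ?thesis by (intro that[of "- \<i>" "- 1" \<i>]) (simp_all add: complex_eq_iff)
  next
    case False
    thus ?thesis using \<kappa> by (intro that[of \<i> "- 1" "- \<i>"]) (auto simp: complex_eq_iff)
  qed
  have mult: "u * v \<in> fourth_roots" if "u \<in> fourth_roots" "v \<in> fourth_roots" for u v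
    using that by auto
  obtain p p' where p: "p \<in> fourth_roots" "p' \<in> fourth_roots" "distinct [1, b8 * \<kappa>, p, p']"
    using complementary_fourth_roots[OF _ mult[OF b(3) \<kappa>] b(8)] by auto
  obtain r r' where r: "r \<in> fourth_roots" "r' \<in> fourth_roots" "distinct [b2, \<kappa>, r, r']"
    using complementary_fourth_roots[OF b(1) \<kappa> b(5)] by auto
  obtain w w' where w: "w \<in> fourth_roots" "w' \<in> fourth_roots" "distinct [b4, b2 * \<kappa>, w, w']"
    using complementary_fourth_roots[OF b(2) mult[OF b(1) \<kappa>] b(6)] by auto
  obtain s s' where s: "s \<in> fourth_roots" "s' \<in> fourth_roots" "distinct [b8, b4 * \<kappa>, s, s']"
    using complementary_fourth_roots[OF b(3) mult[OF b(2) \<kappa>] b(7)] by auto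

  \<comment> \<open>The choice of \<open>x\<close>\<close>
  have orbits1: "distinct (0 # orbit 1)"
    using distinct_orbit[of 1] \<iota>_neq by (simp add: orbit_def)
  have len1: "length (0 # orbit 1) = 5" by (simp add: length_orbit)
  \<comment> \<open>\<open>p\<close> and \<open>p'\<close> complete row \<open>1\<close>;
    \<open>1\<close> and \<open>- 1\<close> fill half of row \<open>3\<close>.\<close>
  have "\<exists>x. map (\<lambda>c. \<chi> (x - c)) (0 # orbit 1) = [b2, p', p, 1, - 1]"
  proof (rule exists_prescribed_classes[OF orbits1 _ _ M], unfold len1)
    show "4 ^ 5 * (real (8 * 5 * q) / real M + real 5) < real q - real 5"
      using large by (simp add: M_def)
  qed (use b(1) p(1,2) num(1) in simp_all)
  then obtain x where x: "map (\<lambda>c. \<chi> (x - c)) (0 # orbit 1) = [b2, p', p, 1, - 1]" ..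
  have x': "\<chi> x = b2" "\<chi> (x - 1) = p'" "\<chi> (x + 1) = p" "\<chi> (x - \<iota>) = 1" "\<chi> (x + \<iota>) = - 1"
    using x by (simp_all add: orbit_def)
  have x0: "x \<noteq> 0" using x'(1) b(1) \<chi>_neq_0 by blast
  have x4: "x ^ 4 \<noteq> 1 ^ 4"
  proof (rule power4_neq)
    fix c assume "c \<in> set (orbit 1)"
    hence "\<chi> (x - c) \<in> fourth_roots" using x' p by (auto simp: orbit_def)
    thus "x \<noteq> c" using \<chi>_neq_0 by fastforce
  qed

  \<comment> \<open>The choice of \<open>y\<close>\<close>
  have orbits2: "distinct (0 # orbit 1 @ orbit x)"
    using orbits1 distinct_orbit[OF x0] orbit_disjoint[OF x4[symmetric]] zero_notin_orbit[OF x0]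
    by simp
  have len2: "length (0 # orbit 1 @ orbit x) = 9" by (simp add: length_orbit)
  \<comment> \<open>\<open>\<i>\<close> and \<open>- \<i>\<close> complete row \<open>3\<close>,
    \<open>r\<close> and \<open>r'\<close> complete row \<open>2\<close>; the two pairs
    \<open>1\<close>, \<open>- 1\<close> fill half of rows \<open>5\<close> and
    \<open>6\<close>.\<close>
  have "\<exists>y. map (\<lambda>c. \<chi> (y - c)) (0 # orbit 1 @ orbit x) = [b4, \<i>, - \<i>, 1, - 1, r', r, 1, - 1]"
  proof (rule exists_prescribed_classes[OF orbits2 _ _ M], unfold len2)
    show "4 ^ 9 * (real (8 * 9 * q) / real M + real 9) < real q - real 9"
      using large by (simp add: M_def)
  qed (use b(2) r(1,2) num(2) in simp_all)
  then obtain y where y: "map (\<lambda>c. \<chi> (y - c)) (0 # orbit 1 @ orbit x) =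
      [b4, \<i>, - \<i>, 1, - 1, r', r, 1, - 1]" ..
  have y': "\<chi> y = b4" "\<chi> (y - 1) = \<i>" "\<chi> (y + 1) = - \<i>" "\<chi> (y - \<iota>) = 1" "\<chi> (y + \<iota>) = - 1"
    "\<chi> (y - x) = r'" "\<chi> (y + x) = r" "\<chi> (y - \<iota> * x) = 1" "\<chi> (y + \<iota> * x) = - 1"
    using y by (simp_all add: orbit_def)
  have y0: "y \<noteq> 0" using y'(1) b(2) \<chi>_neq_0 by blast
  have y4: "y ^ 4 \<noteq> 1 ^ 4" "y ^ 4 \<noteq> x ^ 4"
  proof -
    have "y \<noteq> c" if "c \<in> set (orbit 1) \<union> set (orbit x)" for c
    proof -
      have "\<chi> (y - c) \<in> fourth_roots" using that y' r by (auto simp: orbit_def)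
      thus ?thesis using \<chi>_neq_0 by fastforce
    qed
    thus "y ^ 4 \<noteq> 1 ^ 4" "y ^ 4 \<noteq> x ^ 4" by (auto intro!: power4_neq simp del: power_one)
  qed

  \<comment> \<open>The choice of \<open>z\<close>\<close>
  define cs where "cs = 0 # orbit 1 @ orbit x @ orbit y"
  have cs: "distinct cs"
    using orbits2 distinct_orbit[OF y0] orbit_disjoint[OF y4(1)[symmetric]] orbit_disjoint[OF y4(2)[symmetric]]
      zero_notin_orbit[OF y0] by (simp add: cs_def Int_Un_distrib Int_Un_distrib2)
  \<comment> \<open>Prescribing all \<open>13\<close> characters would cost a factor \<open>4\<^sup>1\<^sup>3\<close>, which the bound on character sums does not
    allow. The rows of \<open>A\<close>, with orders \<open>d\<close>, prescribe five characters and otherwise only ratios and squares;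
    this costs \<open>2\<^sup>2\<^sup>1\<close>.\<close>
  define A :: "nat list list" where "A =
    [[1, 0, 0, 0, 0, 0, 0, 0, 0, 0, 0, 0, 0],
     [0, 0, 0, 1, 0, 0, 0, 0, 0, 0, 0, 0, 0],
     [0, 0, 0, 0, 1, 0, 0, 0, 0, 0, 0, 0, 0],
     [0, 0, 0, 0, 0, 0, 0, 0, 0, 1, 0, 0, 0],
     [0, 0, 0, 0, 0, 0, 0, 0, 0, 0, 1, 0, 0],
     [0, 1, 3, 0, 0, 0, 0, 0, 0, 0, 0, 0, 0],
     [0, 0, 0, 0, 0, 0, 0, 1, 3, 0, 0, 0, 0],
     [0, 0, 2, 0, 0, 0, 0, 0, 2, 0, 0, 0, 0],
     [0, 0, 0, 0, 0, 1, 3, 0, 0, 0, 0, 0, 0],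
     [0, 0, 0, 0, 0, 0, 2, 0, 0, 0, 0, 0, 0],
     [0, 0, 0, 0, 0, 0, 0, 0, 0, 0, 0, 1, 3],
     [0, 0, 0, 0, 0, 0, 0, 0, 0, 0, 0, 0, 2]]"
  \<comment> \<open>Columns follow \<open>cs\<close>. Entries \<open>1, 3\<close> give the ratio of
    the characters of \<open>z - c\<close> and \<open>z + c\<close>, because a cube is an inverse
    here; entries \<open>2\<close> give squares, which are \<open>1\<close> or \<open>- 1\<close>
    and so have order \<open>2\<close>.\<close>
  define d :: "nat list" where "d = [4, 4, 4, 4, 4, 4, 4, 2, 4, 2, 4, 2]"
  define t :: "complex list" where "t = [b8, s', s, w', w, - 1, - 1, - 1, - 1, - 1, - 1, - 1]"
  have less12: "l \<in> {0, 1, 2, 3, 4, 5, 6, 7, 8, 9, 10, 11}" if "l < 12" for l :: nat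
    using that unfolding insert_iff empty_iff by presburger
  have "\<exists>z. z \<notin> (!) cs ` {..<13} \<and> (\<forall>l<12. (\<Prod>j<13. \<chi> (z - cs ! j) ^ (A ! l ! j)) = t ! l)"
  proof (rule exists_prescribed_characters[where d = "\<lambda>l. d ! l" and M = M])
    show "inj_on ((!) cs) {..<13}" using cs by (simp add: inj_on_nth cs_def orbit_def)
    show "0 < d ! l" if "l < 12" for l
      using less12[OF that] by (auto simp: d_def)
    show "4 dvd d ! l * A ! l ! j" if "l < 12" "j < 13" for l j
    proof -
      have "\<forall>a \<in> set (A ! l). 4 dvd d ! l * a"
        using less12[OF that(1)] by (auto simp: d_def A_def)
      moreover have "length (A ! l) = 13" using less12[OF that(1)] by (auto simp: A_def)
      ultimately show ?thesis using that(2) by simp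
    qed
    show "norm (t ! l) = 1 \<and> t ! l ^ d ! l = 1" if "l < 12" for l
    proof -
      have root: "norm u = 1 \<and> u ^ 4 = 1" if "u \<in> fourth_roots" for u
        using that by (auto simp: power4_eq_xxxx)
      show ?thesis
        using less12[OF that] root[OF b(3)] root[OF s(1)] root[OF s(2)] root[OF w(1)] root[OF w(2)]
        by (auto simp: d_def t_def)
    qed
    show "\<forall>l<12. e l = 0" if "\<And>l. l < 12 \<Longrightarrow> e l < d ! l"
      "\<And>j. j < 13 \<Longrightarrow> 4 dvd (\<Sum>l<12. e l * A ! l ! j)" for e :: "nat \<Rightarrow> nat"
    proof -
      have e: "e 0 < 4" "e 1 < 4" "e 2 < 4" "e 3 < 4" "e 4 < 4" "e 5 < 4" "e 6 < 4" "e 7 < 2"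
        "e 8 < 4" "e 9 < 2" "e 10 < 4" "e 11 < 2"
        using that(1)[of 0] that(1)[of 1] that(1)[of 2] that(1)[of 3] that(1)[of 4] that(1)[of 5]
          that(1)[of 6] that(1)[of 7] that(1)[of 8] that(1)[of 9] that(1)[of 10] that(1)[of 11]
        by (simp_all add: d_def)
      \<comment> \<open>Nine columns meet a single row and give nine of the \<open>e l\<close> at
        once; the last three divisibilities then leave \<open>2 * e l\<close> with
        \<open>e l < 2\<close>.\<close>
      have dvd: "4 dvd e 0" "4 dvd e 1" "4 dvd e 2" "4 dvd e 3" "4 dvd e 4" "4 dvd e 5" "4 dvd e 6"
        "4 dvd e 8" "4 dvd e 10" "4 dvd e 5 * 3 + e 7 * 2" "4 dvd e 8 * 3 + e 9 * 2" "4 dvd e 10 * 3 + e 11 * 2"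
        using that(2)[of 0] that(2)[of 3] that(2)[of 4] that(2)[of 9] that(2)[of 10] that(2)[of 1]
          that(2)[of 7] that(2)[of 5] that(2)[of 11] that(2)[of 2] that(2)[of 6] that(2)[of 12]
        by (simp_all add: A_def lessThan_nat_numeral add.commute)
      have *: "u = 0" if "4 dvd u" "u < 4" for u :: nat using that by (auto elim!: dvdE)
      have **: "v = 0" if "4 dvd 0 * 3 + v * 2" "v < 2" for v :: nat using that by presburger
      have "e 0 = 0" "e 1 = 0" "e 2 = 0" "e 3 = 0" "e 4 = 0" "e 5 = 0" "e 6 = 0" "e 8 = 0" "e 10 = 0"
        using *[OF dvd(1) e(1)] *[OF dvd(2) e(2)] *[OF dvd(3) e(3)] *[OF dvd(4) e(4)] *[OF dvd(5) e(5)]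
          *[OF dvd(6) e(6)] *[OF dvd(7) e(7)] *[OF dvd(8) e(9)] *[OF dvd(9) e(11)] by simp_all
      moreover have "e 7 = 0" "e 9 = 0" "e 11 = 0"
        using **[of "e 7"] **[of "e 9"] **[of "e 11"] dvd(10-12) e(8,10,12) calculation by simp_all
      ultimately show ?thesis using less12 by fastforce
    qed
    show "real (\<Prod>l<12. d ! l) * (real (8 * 13 * q) / real M + real 13) < real q - real 13"
      using large by (simp add: d_def M_def lessThan_nat_numeral)
  qed (use M num(3) in simp_all)
  then obtain z where z_notin: "z \<notin> (!) cs ` {..<13}"
    and z: "\<And>l. l < 12 \<Longrightarrow> (\<Prod>j<13. \<chi> (z - cs ! j) ^ (A ! l ! j)) = t ! l" by blast
  have "z \<notin> set cs"
  proof -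
    have "length cs = 13" by (simp add: cs_def length_orbit)
    thus ?thesis using z_notin by (auto simp: in_set_conv_nth)
  qed
  hence nz: "z - c \<noteq> 0" if "c \<in> set cs" for c using that by auto
  have z': "\<chi> z = b8" "\<chi> (z - \<iota>) = s'" "\<chi> (z + \<iota>) = s" "\<chi> (z - y) = w'" "\<chi> (z + y) = w"
    "\<chi> (z - 1) * \<chi> (z + 1) ^ 3 = - 1" "\<chi> (z - \<iota> * x) * \<chi> (z + \<iota> * x) ^ 3 = - 1"
    "(\<chi> (z + 1))\<^sup>2 * (\<chi> (z + \<iota> * x))\<^sup>2 = - 1"
    "\<chi> (z - x) * \<chi> (z + x) ^ 3 = - 1" "(\<chi> (z + x))\<^sup>2 = - 1"
    "\<chi> (z - \<iota> * y) * \<chi> (z + \<iota> * y) ^ 3 = - 1" "(\<chi> (z + \<iota> * y))\<^sup>2 = - 1"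
    using z[of 0] z[of 1] z[of 2] z[of 3] z[of 4] z[of 5] z[of 6] z[of 7] z[of 8] z[of 9] z[of 10] z[of 11]
    by (simp_all add: A_def t_def cs_def orbit_def lessThan_nat_numeral mult.commute)
  have opposite: "\<chi> (z - c) = - \<chi> (z + c)" if "\<chi> (z - c) * \<chi> (z + c) ^ 3 = - 1" "- c \<in> set cs" for c
  proof -
    have "\<chi> (z + c) ^ 4 = 1" using nz[OF that(2)] \<chi>_power4 by simp
    hence "\<chi> (z - c) = (\<chi> (z - c) * \<chi> (z + c) ^ 3) * \<chi> (z + c)"
      by (simp add: mult.assoc eval_nat_numeral)
    thus ?thesis using that(1) by simp
  qed
  have opp: "\<chi> (z - 1) = - \<chi> (z + 1)" "\<chi> (z - \<iota> * x) = - \<chi> (z + \<iota> * x)" "\<chi> (z - x) = - \<chi> (z + x)"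
    "\<chi> (z - \<iota> * y) = - \<chi> (z + \<iota> * y)"
    using z' by (auto intro!: opposite simp: cs_def orbit_def)
  have nz': "\<chi> (z + 1) \<noteq> 0" "\<chi> (z + x) \<noteq> 0" "\<chi> (z + \<iota> * x) \<noteq> 0" "\<chi> (z + \<iota> * y) \<noteq> 0"
    using z' by auto
  have z0: "z \<noteq> 0" using z'(1) b(3) \<chi>_neq_0 by blast

  \<comment> \<open>Verification of the rows\<close>
  have rev: "\<chi> (u - v) = \<chi> (v - u)" for u v using \<chi>_minus[of "u - v"] by simp
  have turn: "\<chi> (u + \<iota> * v) = \<chi> (v - \<iota> * u)" "\<chi> (u - \<iota> * v) = \<chi> (v + \<iota> * u)" for u v
  proof -
    have "u + \<iota> * v = \<iota> * (v - \<iota> * u)" "u - \<iota> * v = - (\<iota> * (v + \<iota> * u))"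
      using \<iota>_neq(5) by (simp_all add: algebra_simps flip: mult.assoc)
    thus "\<chi> (u + \<iota> * v) = \<chi> (v - \<iota> * u)" "\<chi> (u - \<iota> * v) = \<chi> (v + \<iota> * u)"
      using \<chi>_\<iota>_mult \<chi>_minus by metis+
  qed
  have rows: "map (map \<chi>) (quads \<iota> x y z) =
    [map ((*) (\<chi> 2)) [1, b2, b4, b8],
     [1, b8 * \<kappa>, p, p'],
     [b2, \<kappa>, r, r'],
     [- 1, - (- 1), - \<i>, - (- \<i>)],
     [b4, b2 * \<kappa>, w, w'],
     [- 1, - (- 1), - \<chi> (z + \<iota> * y), - (- \<chi> (z + \<iota> * y))],
     [1, - 1, \<chi> (z + x), - \<chi> (z + x)],
     [\<chi> (z + 1), - \<chi> (z + 1), - \<chi> (z + \<iota> * x), - (- \<chi> (z + \<iota> * x))],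
     [b8, b4 * \<kappa>, s, s']]"
    using x0 y0 z0 two_neq_0 \<iota>1
    by (simp add: quads_def \<chi>_mult \<chi>_1 \<kappa>_def x' y' z'(1-5) opp turn[of y z] turn[of x y] turn[of x z]
      add.commute[of 1 x] add.commute[of 1 y] add.commute[of 1 z] add.commute[of x y] add.commute[of y z]
      add.commute[of x z] rev[of 1 x] rev[of 1 y] rev[of 1 z] rev[of x y] rev[of y z] rev[of x z])
  have "\<chi> 2 \<noteq> 0" using \<chi>_cases[OF two_neq_0] by auto
  hence "distinct (map ((*) (\<chi> 2)) [1, b2, b4, b8])"
    unfolding distinct_map using b(4) by (simp only: inj_on_def mult_left_cancel simp_thms) simp
  moreover have "distinct [\<chi> (z + 1), - \<chi> (z + 1), - \<chi> (z + \<iota> * x), - (- \<chi> (z + \<iota> * x))]"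
  proof (rule distinct_opposite_pairs)
    show "(\<chi> (z + 1))\<^sup>2 \<noteq> (- \<chi> (z + \<iota> * x))\<^sup>2"
    proof
      assume "(\<chi> (z + 1))\<^sup>2 = (- \<chi> (z + \<iota> * x))\<^sup>2"
      hence eq: "(\<chi> (z + 1))\<^sup>2 = (\<chi> (z + \<iota> * x))\<^sup>2" by simp
      have "\<chi> (z + 1) ^ 4 = (\<chi> (z + 1))\<^sup>2 * (\<chi> (z + 1))\<^sup>2"
        by (simp flip: power_add)
      also have "\<dots> = (\<chi> (z + 1))\<^sup>2 * (\<chi> (z + \<iota> * x))\<^sup>2" by (simp only: eq)
      also note z'(8)
      finally have "\<chi> (z + 1) ^ 4 = - 1" .
      moreover have "\<chi> (z + 1) ^ 4 = 1"
        using \<chi>_power4[OF nz[of "- 1"]] by (simp add: cs_def orbit_def)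
      ultimately show False by simp
    qed
  qed (use nz' in simp_all)
  moreover have "distinct [- 1, - (- 1), - \<chi> (z + \<iota> * y), - (- \<chi> (z + \<iota> * y))]"
    "distinct [1, - 1, \<chi> (z + x), - \<chi> (z + x)]" "distinct [- 1, - (- 1), - \<i>, - (- \<i>)]"
    using nz' z' by (intro distinct_opposite_pairs; simp)+
  ultimately have "\<forall>us \<in> set (map (map \<chi>) (quads \<iota> x y z)). distinct us"
    unfolding rows using p r w s by (simp del: distinct.simps)
  moreover have "\<forall>us \<in> set (map (map \<chi>) (quads \<iota> x y z)). 0 \<notin> set us"
  proof -
    have "u \<noteq> 0" if "u \<in> fourth_roots" for u using that by auto
    note nonzero = this[OF b(1)] this[OF b(2)] this[OF b(3)] this[OF \<kappa>] this[OF p(1)] this[OF p(2)]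
      this[OF r(1)] this[OF r(2)] this[OF w(1)] this[OF w(2)] this[OF s(1)] this[OF s(2)]
    show ?thesis unfolding rows using nonzero[symmetric] nonzero nz' \<open>\<chi> 2 \<noteq> 0\<close> by simp
  qed
  ultimately have "\<forall>vs \<in> set (quads \<iota> x y z). distinct (map \<chi> vs) \<and> 0 \<notin> \<chi> ` set vs"
    by simp
  thus ?thesis by blast
qed

end

text \<open>With \<open>k = (CARD('a) - 1) div 4\<close>, the polynomial
  \<open>X ^ (2 * k) - 1\<close> has too few roots to contain all units; for a unit \<open>u\<close>
  that is not a root, \<open>u ^ k\<close> squares to \<open>- 1\<close>.\<close>

lemma exists_sqrt_minus_one:
  assumes q: "CHAR('a::finite_field) = CARD('a)" "4 dvd CARD('a) - 1" "4 < CARD('a)"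
  shows "\<exists>i :: 'a. i\<^sup>2 = - 1"
proof -
  define k where "k = (CARD('a) - 1) div 4"
  have k: "CARD('a) - 1 = 4 * k" using q(2) by (simp add: k_def)
  have k0: "0 < k" using q(3) k by (cases k) auto
  define p :: "'a poly" where "p = monom 1 (2 * k) - 1"
  have "coeff p (2 * k) = 1" using k0 by (simp add: p_def)
  hence "p \<noteq> 0" by auto
  hence "card {u. poly p u = 0} \<le> degree p" by (rule card_poly_roots_bound)
  also have "\<dots> \<le> 2 * k"
    unfolding p_def by (intro degree_diff_le degree_monom_le) simp
  also have "2 * k < card (UNIV - {0 :: 'a})" using k k0 by (simp add: card_Diff_subset)
  finally have "\<not> UNIV - {0} \<subseteq> {u. poly p u = 0}"
    by (metis (no_types, lifting) card_mono finite leD)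
  then obtain u where u: "u \<noteq> 0" "poly p u \<noteq> 0" by blast
  have "u ^ (4 * k) = 1"
    using finite_field_power_card_minus_one[OF u(1)] by (simp only: k)
  moreover have "(u ^ (2 * k) - 1) * (u ^ (2 * k) + 1) = u ^ (4 * k) - 1"
    by (simp add: algebra_simps flip: power_add)
  ultimately have "u ^ (2 * k) = - 1"
    using u(2) by (simp add: p_def poly_monom eq_neg_iff_add_eq_0)
  thus ?thesis by (intro exI[of _ "u ^ k"]) (simp add: mult.commute flip: power_mult)
qed

text \<open>The solution in the field is lifted to integer representatives; \<open>quads\<close>
  commutes with the ring homomorphism \<open>of_int\<close>.\<close>

lemma admissible_if_large_CARD:
  assumes q16: "[CARD('p::prime_card) = 1] (mod 16)" and large: "344806 * 10 ^ 12 \<le> CARD('p)"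
  shows "\<exists>i x y z. admissible CARD('p) i x y z"
proof -
  define q where q_CARD: "q = CARD('p)"
  have dvd: "16 dvd q - 1"
    using q16 prime_card[where ?'a = 'p] prime_gt_1_nat[of q] by (simp add: q_CARD cong_altdef_nat)
  hence "4 dvd q - 1" by (rule dvd_trans[rotated]) simp
  then obtain \<iota> :: "'p mod_ring" where \<iota>: "\<iota>\<^sup>2 = - 1"
    using exists_sqrt_minus_one[where ?'a = "'p mod_ring"] large by (auto simp: q_CARD)
  interpret quartic_field \<iota> q
    by unfold_locales (use dvd \<iota> in \<open>simp_all add: q_CARD\<close>)
  obtain x y z where quads: "\<And>vs. vs \<in> set (quads \<iota> x y z) \<Longrightarrow> distinct (map \<chi> vs) \<and> 0 \<notin> \<chi> ` set vs"
    using exists_quads large unfolding q_CARD[symmetric] by blast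
  let ?int = "to_int_mod_ring :: 'p mod_ring \<Rightarrow> int" and ?of_int = "of_int :: int \<Rightarrow> 'p mod_ring"
  have of_int: "?of_int (?int u) = u" for u by (simp add: of_int_of_int_mod_ring)
  have of_int_mod: "?of_int (v mod int q) = ?of_int v" for v
  proof -
    have "?of_int v = ?of_int (int q * (v div int q) + v mod int q)" by simp
    also have "\<dots> = ?of_int (v mod int q)"
      unfolding of_int_add of_int_mult by (simp add: q_CARD)
    finally show ?thesis by simp
  qed
  have dvd_iff: "int q dvd v \<longleftrightarrow> ?of_int v = 0" for v
    by (simp add: of_int_eq_0_iff_char_dvd q_CARD)
  have quads_int: "map (map ?of_int) (quads (?int \<iota>) (?int x) (?int y) (?int z)) = quads \<iota> x y z"
    by (simp add: quads_def of_int)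
  have "admissible q (?int \<iota>) (?int x) (?int y) (?int z)"
    unfolding admissible_def
  proof (intro conjI ballI)
    show "int q dvd (?int \<iota>)\<^sup>2 + 1" unfolding dvd_iff by (simp add: of_int \<iota>)
  next
    fix vs assume "vs \<in> set (quads (?int \<iota>) (?int x) (?int y) (?int z))"
    hence "map ?of_int vs \<in> set (quads \<iota> x y z)"
      unfolding quads_int[symmetric] by simp
    from quads[OF this] have *: "distinct (map (\<lambda>v. \<chi> (?of_int v)) vs)" "0 \<notin> (\<lambda>v. \<chi> (?of_int v)) ` set vs"
      by (simp_all add: comp_def image_image)
    \<comment> \<open>The character is a function of the power alone, so distinct characters force
      distinct powers modulo \<open>q\<close>.\<close>
    obtain \<phi> where \<phi>: "\<And>u. \<chi> u = \<phi> (u ^ ((q - 1) div 4))"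
    proof
      show "\<chi> u = (if u ^ ((q - 1) div 4) = 1 then 1 else if u ^ ((q - 1) div 4) = \<iota> then \<i> else
        if u ^ ((q - 1) div 4) = - 1 then - 1 else if u ^ ((q - 1) div 4) = - \<iota> then - \<i> else 0)" for u
        unfolding quartic_char_def q_def Let_def ..
    qed
    have "\<chi> (?of_int v) = \<phi> (?of_int (v ^ ((q - 1) div 4) mod int q))" for v
      by (simp add: \<phi> of_int_mod)
    hence "distinct (map (\<lambda>w. \<phi> (?of_int w)) (map (\<lambda>v. v ^ ((q - 1) div 4) mod int q) vs))"
      using *(1) by (simp add: comp_def)
    thus "distinct (map (\<lambda>v. v ^ ((q - 1) div 4) mod int q) vs)"
      unfolding distinct_map by blast
    show "\<not> int q dvd v" if "v \<in> set vs" for v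
      using *(2) that \<chi>_0 unfolding dvd_iff by force
  qed
  thus ?thesis unfolding q_CARD by blast
qed

text \<open>The result above concerns types of prime cardinality, and a type cannot depend on the variable \<open>q\<close>.
  It is therefore applied to a type whose cardinality is a counterexample, should there be one.\<close>

definition counterexample :: "nat \<Rightarrow> bool" where
  "counterexample q \<longleftrightarrow> prime q \<and> [q = 1] (mod 16) \<and> 344806 * 10 ^ 12 \<le> q \<and>
     \<not> (\<exists>i x y z. admissible q i x y z)"

text \<open>The default \<open>2\<close> is prime, so the type below has prime cardinality in either
  case.\<close>

definition candidate :: nat where
  "candidate = (if \<exists>q. counterexample q then SOME q. counterexample q else 2)"

lemma prime_candidate: "prime candidate"
proof (cases "\<exists>q. counterexample q")
  case True
  hence "counterexample candidate"
    unfolding candidate_def using someI_ex[of counterexample] by simp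
  thus ?thesis unfolding counterexample_def by blast
next
  case False
  thus ?thesis unfolding candidate_def by (simp only: if_False two_is_prime_nat)
qed

typedef candidate_residues = "{..<candidate}"
  using prime_gt_0_nat[OF prime_candidate] by blast

lemma CARD_candidate_residues: "CARD(candidate_residues) = candidate"
  using type_definition.card[OF type_definition_candidate_residues] by simp

instance candidate_residues :: prime_card
  by standard (simp add: CARD_candidate_residues prime_candidate)

lemma large_primes_admissible:
  assumes "prime q" "[q = 1] (mod 16)" "344806 * 10 ^ 12 \<le> q"
  shows "\<exists>i x y z. admissible q i x y z"
proof (rule ccontr)
  assume "\<not> ?thesis"
  hence "\<exists>q. counterexample q" using assms unfolding counterexample_def by blast
  hence "counterexample candidate"
    unfolding candidate_def using someI_ex[of counterexample] by simp
  thus False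
    using admissible_if_large_CARD[where ?'p = candidate_residues]
    by (simp add: counterexample_def CARD_candidate_residues)
qed

theorem theorem3p7:
  fixes q :: nat
  assumes "prime q" and "[q = 1] (mod 16)"
    and "real q > Q_bound 4 13 \<or> q \<in> S17 \<or> (6673 \<le> q \<and> q \<le> 9857)"
  shows "\<exists>Bs. relative_difference_family
           (prime_field_add 17 \<times>\<times> prime_field_add q)
           (carrier (prime_field_add 17) \<times> {\<zero>\<^bsub>residue_ring (int q)\<^esub>}) 17 1 Bs"
proof -
  have "\<exists>i x y z. admissible q i x y z"
  proof (cases "real q > Q_bound 4 13")
    case True
    \<comment> \<open>\<open>Q_bound_4_13\<close> locates the bound within
      \<open>10 ^ 12 / 2\<close> of \<open>344807 * 10 ^ 12\<close>, so lowering the leading digits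
      by one is safe.\<close>
    hence "real (344806 * 10 ^ 12) < real q" using Q_bound_4_13 by (simp add: abs_if split: if_splits)
    hence "344806 * 10 ^ 12 \<le> q" by linarith
    thus ?thesis by (rule large_primes_admissible[OF assms(1,2)])
  next
    case False
    thus ?thesis using assms small_primes_admissible by blast
  qed
  thus ?thesis using relative_difference_family_if_admissible[OF assms(1,2)] by blast
qed

end
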